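(* Let $2\le d\le n$. Then $$\mu_{n,d}^{\operatorname{tr}}=2\left(1-\frac{1}{\mu_{n,d}^{\max}}\right)\qquad\text{and}\qquad \pi_{n,d}^{\operatorname{tr}}=1-\frac{1}{\pi_{n,d}^{\max}}.$$ Moreover, if $(z_1,\dots,z_n)\in\mathbb{C}^n$ with $\sum_{k=1}^n|z_k|=1$ is an optimal solution attaining $\mu_{n,d}^{\max}$, then the corresponding pair $(s,t)$ of the optimization problem for $\mu_{n,d}^{\operatorname{tr}}$ (which attains $\mu_{n,d}^{\operatorname{tr}}$) satisfies, up to permutation of $s$ and $t$, $$s=1-\frac{1}{\mu_{n,d}^{\max}}\left(1-\Big|\sum_{j=1}^n z_j\Big|\right),\qquad t=1-\frac{1}{\mu_{n,d}^{\max}}\left(1+\Big|\sum_{j=1}^n z_j\Big|\right).$$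
   Context: $\mathcal{S}^{n,d}$ is the set of real symmetric $n\times n$ matrices all of whose $d\times d$ principal submatrices are positive semidefinite. $\lambda(\mathcal{S}^{n,d})$ is the set of all $(\lambda_1,\dots,\lambda_n)\in\mathbb{R}^n$ such that some $X\in\mathcal{S}^{n,d}$ is similar to $\operatorname{diag}(\lambda_1,\dots,\lambda_n)$. Define $$\mu_{n,d}^{\operatorname{tr}}:=\min\{s+t : (1,\dots,1,s,t)\in\lambda(\mathcal{S}^{n,d})\},\qquad \pi_{n,d}^{\operatorname{tr}}:=\min\{t : (1,\dots,1,t,t)\in\lambda(\mathcal{S}^{n,d})\}$$ (with $n-2$ ones). With $\binom{[n]}{d}$ the set of $d$-element subsets of $\{1,\dots,n\}$, define $$\mu_{n,d}^{\max}:=\min\Big\{\max_{S\in\binom{[n]}{d}}\Big(\sum_{s\in S}|z_s|+\Big|\sum_{s\in S}z_s\Big|\Big) : z_1,\dots,z_n\in\mathbb{C},\ \sum_{k=1}^n|z_k|=1\Big\},$$ $$\pi_{n,d}^{\max}:=\min\Big\{\max_{S\in\binom{[n]}{d}}\Big(\sum_{s\in S}|z_s|+\Big|\sum_{s\in S}z_s\Big|\Big) : z_1,\dots,z_n\in\mathbb{C},\ \sum_{k=1}^n|z_k|=1,\ \sum_{k=1}^n z_k=0\Big\}.$$ Correspondence: given $(z_1,\dots,z_n)$ optimal for $\mu_{n,d}^{\max}$, write $z_j=a_j^2(\cos 2\beta_j+\mathrm{i}\sin 2\beta_j)$ with $a_j,\beta_j\in\mathbb{R}$, and let $A\in\mathbb{R}^{2\times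 n}$ be the matrix whose $j$-th column is $(a_j\cos\beta_j,\ a_j\sin\beta_j)^\top$. The corresponding pair $(s,t)$ is the one for which $M=I_n-\frac{2}{\mu_{n,d}^{\max}}A^\top A$ is similar to $\operatorname{diag}(1,\dots,1,s,t)$; this $M$ is the associated matrix in $\mathcal{S}^{n,d}$. *)

theory Defs
  imports Complex_Main "Jordan_Normal_Form.Matrix" "Jordan_Normal_Form.DL_Submatrix"
begin

definition symmetric_mat :: "real mat \<Rightarrow> bool" where
  "symmetric_mat A \<longleftrightarrow> A \<in> carrier_mat (dim_row A) (dim_row A) \<and> transpose_mat A = A"

definition psd_mat :: "real mat \<Rightarrow> bool" where
  "psd_mat A \<longleftrightarrow> symmetric_mat A \<and>
     (\<forall>v \<in> carrier_vec (dim_row A). 0 \<le> v \<bullet> (A *\<^sub>v v))"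

text \<open>Indices run over \<open>{..<n}\<close> instead of \<open>{1, \<dots>, n}\<close>.\<close>

definition subsets_of_size :: "nat \<Rightarrow> nat \<Rightarrow> nat set set" where
  "subsets_of_size n d = {S. S \<subseteq> {..<n} \<and> card S = d}"

definition locally_psd :: "nat \<Rightarrow> nat \<Rightarrow> real mat set" where
  "locally_psd n d = {X \<in> carrier_mat n n. symmetric_mat X \<and>
     (\<forall>S \<in> subsets_of_size n d. psd_mat (submatrix X S S))}"

definition diag_of_vec :: "'a::zero vec \<Rightarrow> 'a mat" where
  "diag_of_vec v = mat_diag (dim_vec v) (\<lambda>i. v $ i)"

definition spectra :: "nat \<Rightarrow> real mat set \<Rightarrow> real vec set" where
  "spectra n \<X> = {v \<in> carrier_vec n. \<exists>X \<in> \<X>. similar_mat X (diag_of_vec v)}"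

text \<open>The vector \<open>(1, \<dots>, 1, s, t)\<close> with \<open>n - 2\<close> ones, for \<open>n \<ge> 2\<close>.\<close>

definition ones_pair :: "nat \<Rightarrow> real \<Rightarrow> real \<Rightarrow> real vec" where
  "ones_pair n s t = vec n (\<lambda>i. if i < n - 2 then 1 else if i = n - 2 then s else t)"

definition is_minimum :: "real \<Rightarrow> real set \<Rightarrow> bool" where
  "is_minimum m V \<longleftrightarrow> m \<in> V \<and> (\<forall>x \<in> V. m \<le> x)"

text \<open>Each minimum below is the \<open>LEAST\<close> element of its set of objective values. As \<open>LEAST\<close> is
  unspecified when there is no least element, existence has to be asserted separately, by
  \<^const>\<open>is_minimum\<close>.\<close>

definition mu_tr_values :: "nat \<Rightarrow> nat \<Rightarrow> real set" where
  "mu_tr_values n d = {s + t |s t. ones_pair n s t \<in> spectra n (locally_psd n d)}"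

definition mu_tr :: "nat \<Rightarrow> nat \<Rightarrow> real" where
  "mu_tr n d = (LEAST x. x \<in> mu_tr_values n d)"

definition pi_tr_values :: "nat \<Rightarrow> nat \<Rightarrow> real set" where
  "pi_tr_values n d = {t. ones_pair n t t \<in> spectra n (locally_psd n d)}"

definition pi_tr :: "nat \<Rightarrow> nat \<Rightarrow> real" where
  "pi_tr n d = (LEAST x. x \<in> pi_tr_values n d)"

definition max_objective :: "nat \<Rightarrow> nat \<Rightarrow> complex vec \<Rightarrow> real" where
  "max_objective n d z =
     Max ((\<lambda>S. (\<Sum>s\<in>S. cmod (z $ s)) + cmod (\<Sum>s\<in>S. z $ s)) ` subsets_of_size n d)"

definition mu_max_feasible :: "nat \<Rightarrow> complex vec set" where
  "mu_max_feasible n = {z \<in> carrier_vec n. (\<Sum>k<n. cmod (z $ k)) = 1}"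

definition pi_max_feasible :: "nat \<Rightarrow> complex vec set" where
  "pi_max_feasible n =
     {z \<in> carrier_vec n. (\<Sum>k<n. cmod (z $ k)) = 1 \<and> (\<Sum>k<n. z $ k) = 0}"

definition mu_max :: "nat \<Rightarrow> nat \<Rightarrow> real" where
  "mu_max n d = (LEAST x. x \<in> max_objective n d ` mu_max_feasible n)"

definition pi_max :: "nat \<Rightarrow> nat \<Rightarrow> real" where
  "pi_max n d = (LEAST x. x \<in> max_objective n d ` pi_max_feasible n)"

definition mu_max_optimal :: "nat \<Rightarrow> nat \<Rightarrow> complex vec \<Rightarrow> bool" where
  "mu_max_optimal n d z \<longleftrightarrow> z \<in> mu_max_feasible n \<and> max_objective n d z = mu_max n d"

definition polar_data :: "nat \<Rightarrow> complex vec \<Rightarrow> (nat \<Rightarrow> real) \<Rightarrow> (nat \<Rightarrow> real) \<Rightarrow> bool" where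
  "polar_data n z a \<beta> \<longleftrightarrow>
     (\<forall>j<n. z $ j = complex_of_real ((a j)\<^sup>2) * Complex (cos (2 * \<beta> j)) (sin (2 * \<beta> j)))"

definition polar_mat :: "nat \<Rightarrow> (nat \<Rightarrow> real) \<Rightarrow> (nat \<Rightarrow> real) \<Rightarrow> real mat" where
  "polar_mat n a \<beta> =
     mat 2 n (\<lambda>(i, j). if i = 0 then a j * cos (\<beta> j) else a j * sin (\<beta> j))"

definition associated_mat :: "nat \<Rightarrow> nat \<Rightarrow> (nat \<Rightarrow> real) \<Rightarrow> (nat \<Rightarrow> real) \<Rightarrow> real mat" where
  "associated_mat n d a \<beta> =
     1\<^sub>m n - (2 / mu_max n d) \<cdot>\<^sub>m (transpose_mat (polar_mat n a \<beta>) * polar_mat n a \<beta>)"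

end

theory Submission
  imports Defs "Jordan_Normal_Form.Determinant" "HOL-Analysis.Function_Topology" "HOL-Analysis.L2_Norm"
begin

text \<open>A symmetric matrix with spectrum \<open>(1, \<dots>, 1, s, t)\<close> is
\<open>I - p u u\<^sup>T - r v v\<^sup>T\<close> with \<open>p = 1 - s\<close>, \<open>r = 1 - t\<close> and orthonormal \<open>u, v\<close>
(\<open>similar_ones_pairE\<close>, \<open>similar_ones_pairI\<close>), so minimizing \<open>s + t\<close> means maximizing
\<open>p + r\<close>. If \<open>p, r \<ge> 0\<close>, the two vectors \<open>x = \<surd>p u\<close> and \<open>y = \<surd>r v\<close> combine into
complex numbers \<open>x\<^sub>j + \<i> y\<^sub>j\<close>. Their squares \<open>\<zeta>\<^sub>j\<close> remember exactly what the
principal submatrices see: the largest eigenvalue of the \<open>2 \<times> 2\<close> Gram matrix of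
\<open>x\<close> and \<open>y\<close> restricted to \<open>S\<close>, whose nonzero eigenvalues are those of
\<open>x x\<^sup>T + y y\<^sup>T\<close> on \<open>S\<close>, equals half of
\<open>\<Sum>\<^bsub>j\<in>S\<^esub> |\<zeta>\<^sub>j| + |\<Sum>\<^bsub>j\<in>S\<^esub> \<zeta>\<^sub>j|\<close>. Hence the submatrix on \<open>S\<close> is positive
semidefinite iff this quantity is at most \<open>2\<close> (\<open>frame_bound_iff\<close>), while the total
\<open>\<Sum>\<^sub>j |\<zeta>\<^sub>j|\<close> is the trace \<open>p + r\<close>. Normalizing the total to \<open>1\<close> turns the bound \<open>2\<close>
into \<open>2 / (p + r)\<close>, whence \<open>p + r \<le> 2 / \<mu>\<close> for the optimal value \<open>\<mu>\<close> of the complex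
problem. The condition \<open>p = r\<close> of the second problem corresponds to
\<open>\<Sum>\<^sub>j \<zeta>\<^sub>j = 0\<close>, since the real and imaginary part of this sum are
\<open>|x|\<^sup>2 - |y|\<^sup>2\<close> and \<open>2 x \<bullet> y\<close>.

An eigenvalue \<open>t > 1\<close> makes \<open>r\<close> negative and the complex encoding breaks down. Such a matrix
is no better: the positive parts of the diagonal of \<open>p u u\<^sup>T + r v v\<^sup>T\<close>, taken as real
numbers \<open>\<zeta>\<^sub>j\<close>, satisfy the same bounds and have total at least \<open>p + r\<close>
(\<open>feasible_of_indefinite\<close>).

Conversely, square roots of a feasible point \<open>z\<close> give back \<open>x\<close> and \<open>y\<close>. Multiplying all
square roots by a common unit \<open>e\<close> does not change \<open>x x\<^sup>T + y y\<^sup>T\<close>, and choosing \<open>e\<close> so that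
\<open>e\<^sup>2 \<Sum>\<^sub>j z\<^sub>j \<ge> 0\<close> makes \<open>x\<close> and \<open>y\<close> orthogonal with squared norms
\<open>(1 \<plusminus> |\<Sum>\<^sub>j z\<^sub>j|) / 2\<close> (\<open>feasible_diagonalization\<close>). This yields both the attainment of the bound and the
formula for \<open>s\<close> and \<open>t\<close>. Minimizers of the complex problem exist by compactness
(\<open>max_objective_attains_min\<close>).\<close>

section \<open>Orthonormal families in coordinates\<close>

text \<open>Vectors are functions on indices, of which only the values below \<open>n\<close> count. This keeps induction
on the length \<open>k\<close> of the family free of carrier side conditions.\<close>
definition orthonormal :: "nat \<Rightarrow> nat \<Rightarrow> (nat \<Rightarrow> nat \<Rightarrow> real) \<Rightarrow> bool" where
  "orthonormal n k w \<longleftrightarrow> (\<forall>i<k. \<forall>j<k. (\<Sum>l<n. w i l * w j l) = (if i = j then 1 else 0))"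

lemma orthonormal_Suc:
  assumes w: "orthonormal n k w"
    and v: "(\<Sum>l<n. v l * v l) = 1" "\<And>i. i < k \<Longrightarrow> (\<Sum>l<n. w i l * v l) = 0"
  shows "orthonormal n (Suc k) (w(k := v))"
proof -
  have "(\<Sum>l<n. v l * w i l) = 0" if "i < k" for i
    using v(2)[OF that] by (simp add: mult.commute)
  then show ?thesis
    using w v unfolding orthonormal_def by (auto simp: less_Suc_eq)
qed

lemma exists_normalizing_factor:
  fixes v :: "nat \<Rightarrow> real"
  assumes "j < n" "v j \<noteq> 0"
  obtains c where "c \<noteq> 0" "(\<Sum>l<n. (c * v l) * (c * v l)) = 1"
proof -
  define N where "N = (\<Sum>l<n. v l * v l)"
  have "0 < v j * v j" using assms by (metis not_real_square_gt_zero)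
  also have "\<dots> \<le> N" unfolding N_def
    using assms by (intro member_le_sum) auto
  finally have N: "N > 0" .
  define c where "c = 1 / sqrt N"
  have "(\<Sum>l<n. (c * v l) * (c * v l)) = c\<^sup>2 * N"
    unfolding N_def by (simp add: sum_distrib_left power2_eq_square mult_ac)
  also have "\<dots> = 1" using N by (simp add: c_def power_divide)
  finally show ?thesis using that[of c] N by (simp add: c_def)
qed

lemma sum_scale_right:
  fixes f g :: "nat \<Rightarrow> real"
  shows "(\<Sum>l\<in>A. f l * (b * g l)) = b * (\<Sum>l\<in>A. f l * g l)"
  by (simp add: sum_distrib_left mult.left_commute)

text \<open>The matrix with rows \<open>w\<^sub>0, \<dots>, w\<^bsub>k-1\<^esub>\<close>, padded by zero rows, is singular, because
its transpose kills the last unit vector. Any nonzero vector of its kernel is orthogonal to all \<open>w\<^sub>i\<close>.\<close>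
lemma exists_orthogonal_unit:
  fixes w :: "nat \<Rightarrow> nat \<Rightarrow> real"
  assumes "k < n"
  obtains v where "(\<Sum>l<n. v l * v l) = 1" "\<And>i. i < k \<Longrightarrow> (\<Sum>l<n. w i l * v l) = 0"
proof -
  define A where "A = mat n n (\<lambda>(i, l). if i < k then w i l else 0)"
  have A: "A \<in> carrier_mat n n" by (simp add: A_def)
  have "transpose_mat A *\<^sub>v unit_vec n (n - 1) = 0\<^sub>v n"
    using assms by (intro eq_vecI) (auto simp: A_def scalar_prod_right_unit)
  moreover have "unit_vec n (n - 1) \<noteq> (0\<^sub>v n :: real vec)" using assms by simp
  ultimately have "det (transpose_mat A) = 0"
    using A by (subst det_0_iff_vec_prod_zero_field[where n = n]) (auto intro!: exI[of _ "unit_vec n (n - 1)"])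
  then have "det A = 0" using A by (simp add: det_transpose)
  then obtain y where y: "y \<in> carrier_vec n" "y \<noteq> 0\<^sub>v n" "A *\<^sub>v y = 0\<^sub>v n"
    using det_0_iff_vec_prod_zero_field[OF A] by auto
  obtain j where "j < n" "y $ j \<noteq> 0"
    using y(1,2) by (metis carrier_vecD eq_vecI index_zero_vec)
  then obtain c where c: "c \<noteq> 0" "(\<Sum>l<n. (c * y $ l) * (c * y $ l)) = 1"
    using exists_normalizing_factor[of j n "\<lambda>l. y $ l"] by blast
  show ?thesis
  proof (rule that)
    show "(\<Sum>l<n. (c * y $ l) * (c * y $ l)) = 1" by (fact c)
    fix i assume i: "i < k"
    have "(A *\<^sub>v y) $ i = (\<Sum>l<n. w i l * y $ l)"
      using i assms y(1) by (simp add: A_def scalar_prod_def lessThan_atLeast0)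
    then have "(\<Sum>l<n. w i l * y $ l) = 0" using y(3) i assms by simp
    then show "(\<Sum>l<n. w i l * (c * y $ l)) = 0"
      by (simp add: sum_scale_right)
  qed
qed

lemma orthonormal_extend:
  assumes "k \<le> m" "m \<le> n" "orthonormal n k w"
  shows "\<exists>w'. orthonormal n m w' \<and> (\<forall>i<k. w' i = w i)"
  using assms
proof (induction m rule: dec_induct)
  case base
  then show ?case by auto
next
  case (step m)
  then obtain w' where w': "orthonormal n m w'" "\<forall>i<k. w' i = w i" by auto
  obtain v where v: "(\<Sum>l<n. v l * v l) = 1" "\<And>i. i < m \<Longrightarrow> (\<Sum>l<n. w' i l * v l) = 0"
    using exists_orthogonal_unit[of m n w'] step.prems by auto
  have "\<forall>i<k. (w'(m := v)) i = w i" using w'(2) step.hyps by auto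
  then show ?case using orthonormal_Suc[OF w'(1) v] by blast
qed

text \<open>A left inverse of a square matrix is a right inverse, so orthonormal rows entail orthonormal columns.\<close>
lemma orthonormal_rows_columns:
  assumes w: "orthonormal n n w" and "k < n" "l < n"
  shows "(\<Sum>i<n. w i k * w i l) = (if k = l then 1 else 0)"
proof -
  define W where "W = mat n n (\<lambda>(i, l). w i l)"
  have W: "W \<in> carrier_mat n n" by (simp add: W_def)
  have "W * transpose_mat W = 1\<^sub>m n"
    using w by (intro eq_matI) (auto simp: W_def orthonormal_def scalar_prod_def lessThan_atLeast0)
  then have "transpose_mat W * W = 1\<^sub>m n"
    using W mat_mult_left_right_inverse[of W n "transpose_mat W"] by simp
  then have "(transpose_mat W * W) $$ (k, l) = (1\<^sub>m n) $$ (k, l)" by simp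
  then show ?thesis using assms(2,3)
    by (simp add: W_def scalar_prod_def lessThan_atLeast0)
qed

definition orthonormal_pair :: "nat \<Rightarrow> (nat \<Rightarrow> real) \<Rightarrow> (nat \<Rightarrow> real) \<Rightarrow> bool" where
  "orthonormal_pair n u v \<longleftrightarrow>
     (\<Sum>l<n. u l * u l) = 1 \<and> (\<Sum>l<n. v l * v l) = 1 \<and> (\<Sum>l<n. u l * v l) = 0"

text \<open>When \<open>q = 0\<close>, the vector \<open>y\<close> vanishes and gives no direction; any unit vector
orthogonal to \<open>u\<close> then serves, which is where \<open>2 \<le> n\<close> enters.\<close>
lemma unit_vector_along:
  assumes n: "2 \<le> n" and u: "(\<Sum>l<n. u l * u l) = 1"
    and y: "(\<Sum>l<n. u l * y l) = 0" "(\<Sum>l<n. y l * y l) = q"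
  obtains v where "orthonormal_pair n u v" "\<And>l. l < n \<Longrightarrow> y l = sqrt q * v l"
proof (cases "q = 0")
  case True
  obtain v where "(\<Sum>l<n. v l * v l) = 1" "(\<Sum>l<n. u l * v l) = 0"
    using exists_orthogonal_unit[of 1 n "\<lambda>_. u"] n by auto
  then have "orthonormal_pair n u v" using u by (simp add: orthonormal_pair_def)
  moreover have "y l = 0" if "l < n" for l
  proof -
    have "y l * y l \<le> (\<Sum>l<n. y l * y l)" using that by (intro member_le_sum) auto
    then have "y l * y l \<le> 0" using y(2) True by simp
    then show ?thesis by (metis mult_eq_0_iff not_square_less_zero order_le_less)
  qed
  ultimately show ?thesis using that True by simp
next
  case False
  have "0 \<le> q" unfolding y(2)[symmetric] by (intro sum_nonneg) simp
  then have q: "0 < q" using False by simp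
  define c where "c = 1 / sqrt q"
  define v where "v l = c * y l" for l
  have "(\<Sum>l<n. v l * v l) = c\<^sup>2 * (\<Sum>l<n. y l * y l)"
    by (simp add: v_def sum_distrib_left power2_eq_square mult_ac)
  also have "\<dots> = 1" using q by (simp add: y(2) c_def power_divide)
  finally have "(\<Sum>l<n. v l * v l) = 1" .
  moreover have "(\<Sum>l<n. u l * v l) = 0" unfolding v_def sum_scale_right y(1) by simp
  ultimately have "orthonormal_pair n u v" using u by (simp add: orthonormal_pair_def)
  then show ?thesis using that[of v] q by (simp add: v_def c_def)
qed

section \<open>Orthogonal diagonalization of a symmetric diagonalizable matrix\<close>

text \<open>A basis of eigenvectors of a symmetric matrix can be made orthonormal without reordering the
eigenvalues: eigenvectors for different eigenvalues are orthogonal already, so the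
Gram-Schmidt process subtracts from \<open>c\<^sub>j\<close> only eigenvectors for the same eigenvalue
\<open>ev j\<close>.\<close>
lemma gram_schmidt_eigenvectors:
  fixes X c :: "nat \<Rightarrow> nat \<Rightarrow> real" and ev :: "nat \<Rightarrow> real"
  assumes sym: "\<And>k l. k < n \<Longrightarrow> l < n \<Longrightarrow> X k l = X l k"
    and eigen: "\<And>i k. i < n \<Longrightarrow> k < n \<Longrightarrow> (\<Sum>l<n. X k l * c i l) = ev i * c i k"
    and indep: "\<And>y. \<forall>k<n. (\<Sum>i<n. y i * c i k) = 0 \<Longrightarrow> \<forall>i<n. y i = 0"
  obtains w where "orthonormal n n w"
    "\<And>i k. i < n \<Longrightarrow> k < n \<Longrightarrow> (\<Sum>l<n. X k l * w i l) = ev i * w i k"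
proof -
  \<comment> \<open>The last conjunct says that the vectors found so far lie in the span of \<open>c 0, \<dots>, c (j - 1)\<close>; it makes the next Gram-Schmidt vector nonzero.\<close>
  have "\<exists>w. orthonormal n j w
      \<and> (\<forall>i<j. \<forall>k<n. (\<Sum>l<n. X k l * w i l) = ev i * w i k)
      \<and> (\<forall>i<j. \<exists>y. (\<forall>l\<ge>j. y l = 0) \<and> (\<forall>k<n. w i k = (\<Sum>l<n. y l * c l k)))"
    if "j \<le> n" for j
    using that
  proof (induction j)
    case 0
    then show ?case by (simp add: orthonormal_def)
  next
    case (Suc j)
    then have j: "j < n" by simp
    from Suc obtain w where w: "orthonormal n j w"
      and weig: "\<And>i k. i < j \<Longrightarrow> k < n \<Longrightarrow> (\<Sum>l<n. X k l * w i l) = ev i * w i k"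
      and "\<forall>i<j. \<exists>y. (\<forall>l\<ge>j. y l = 0) \<and> (\<forall>k<n. w i k = (\<Sum>l<n. y l * c l k))"
      by auto
    then obtain y where y0: "\<And>i l. i < j \<Longrightarrow> l \<ge> j \<Longrightarrow> y i l = 0"
      and yw: "\<And>i k. i < j \<Longrightarrow> k < n \<Longrightarrow> w i k = (\<Sum>l<n. y i l * c l k)" by metis
    define a where "a i = (\<Sum>l<n. w i l * c j l)" for i
    \<comment> \<open>By symmetry the projection coefficient \<open>a i\<close> vanishes unless the two eigenvalues agree.\<close>
    have a_ev: "a i * ev i = a i * ev j" if i: "i < j" for i
    proof -
      have "ev i * a i = (\<Sum>k<n. (\<Sum>l<n. X k l * w i l) * c j k)"
        unfolding a_def sum_distrib_left using weig[OF i] by (simp add: mult.assoc)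
      also have "\<dots> = (\<Sum>k<n. \<Sum>l<n. X k l * w i l * c j k)" by (simp add: sum_distrib_right)
      also have "\<dots> = (\<Sum>l<n. \<Sum>k<n. X k l * w i l * c j k)" by (rule sum.swap)
      also have "\<dots> = (\<Sum>l<n. w i l * (\<Sum>k<n. X l k * c j k))"
        unfolding sum_distrib_left by (intro sum.cong refl) (simp add: sym mult_ac)
      also have "\<dots> = (\<Sum>l<n. w i l * (ev j * c j l))" using eigen[OF j] by simp
      also have "\<dots> = ev j * a i" by (simp add: a_def sum_distrib_left mult_ac)
      finally show ?thesis by (simp add: mult.commute)
    qed
    define v where "v k = c j k - (\<Sum>i<j. a i * w i k)" for k
    define x where "x l = (if l = j then 1 else 0) - (\<Sum>i<j. a i * y i l)" for l
    \<comment> \<open>The coefficient of \<open>c j\<close> in \<open>v\<close> is 1, so independence forces \<open>v \<noteq> 0\<close>.\<close>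
    have xj: "x j = 1" unfolding x_def using y0 by simp
    have x0: "x l = 0" if "l \<ge> Suc j" for l unfolding x_def using y0 that by simp
    have vx: "v k = (\<Sum>l<n. x l * c l k)" if k: "k < n" for k
    proof -
      have "x l * c l k = (if l = j then c j k else 0) - (\<Sum>i<j. a i * y i l * c l k)" for l
        by (simp add: x_def left_diff_distrib sum_distrib_right)
      then have "(\<Sum>l<n. x l * c l k) = c j k - (\<Sum>l<n. \<Sum>i<j. a i * y i l * c l k)"
        using j by (simp add: sum_subtractf)
      also have "(\<Sum>l<n. \<Sum>i<j. a i * y i l * c l k) = (\<Sum>i<j. a i * w i k)"
        by (subst sum.swap) (simp add: yw[OF _ k] sum_distrib_left mult.assoc)
      finally show ?thesis by (simp add: v_def)
    qed
    \<comment> \<open>Hence subtracting the projections preserves the eigenvalue.\<close>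
    have veig: "(\<Sum>l<n. X k l * v l) = ev j * v k" if k: "k < n" for k
    proof -
      have "(\<Sum>l<n. X k l * v l) = (\<Sum>l<n. X k l * c j l) - (\<Sum>l<n. \<Sum>i<j. a i * (X k l * w i l))"
        unfolding v_def by (simp add: right_diff_distrib sum_subtractf sum_distrib_left mult_ac)
      also have "(\<Sum>l<n. \<Sum>i<j. a i * (X k l * w i l)) = (\<Sum>i<j. a i * (ev i * w i k))"
        by (subst sum.swap) (simp add: weig[OF _ k] flip: sum_distrib_left)
      also have "\<dots> = ev j * (\<Sum>i<j. a i * w i k)"
        unfolding sum_distrib_left using a_ev by (intro sum.cong refl) (simp flip: mult.assoc)
      finally show ?thesis using eigen[OF j k] by (simp add: v_def right_diff_distrib)
    qed
    have vorth: "(\<Sum>l<n. w i l * v l) = 0" if i: "i < j" for i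
    proof -
      have "(\<Sum>l<n. w i l * v l) = a i - (\<Sum>l<n. \<Sum>m<j. a m * (w i l * w m l))"
        unfolding v_def a_def by (simp add: right_diff_distrib sum_subtractf sum_distrib_left mult_ac)
      also have "(\<Sum>l<n. \<Sum>m<j. a m * (w i l * w m l)) = (\<Sum>m<j. a m * (if i = m then 1 else 0))"
        using w i by (subst sum.swap) (simp add: orthonormal_def flip: sum_distrib_left)
      also have "\<dots> = a i"
        using i by (simp add: if_distrib[of "\<lambda>t. _ * t"] cong: if_cong)
      finally show ?thesis by simp
    qed
    have "\<exists>k<n. v k \<noteq> 0"
    proof (rule ccontr)
      assume "\<not> ?thesis"
      then have "\<forall>k<n. (\<Sum>l<n. x l * c l k) = 0" using vx by auto
      then have "x j = 0" using indep j by blast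
      then show False using xj by simp
    qed
    then obtain k where "k < n" "v k \<noteq> 0" by auto
    then obtain b where b: "b \<noteq> 0" "(\<Sum>l<n. (b * v l) * (b * v l)) = 1" by (rule exists_normalizing_factor)
    define w' where "w' = w(j := \<lambda>l. b * v l)"
    have "orthonormal n (Suc j) w'" unfolding w'_def
      by (rule orthonormal_Suc[OF w b(2)]) (simp add: vorth sum_scale_right)
    moreover have "(\<Sum>l<n. X k l * w' i l) = ev i * w' i k" if "i < Suc j" "k < n" for i k
    proof (cases "i = j")
      case True
      have "(\<Sum>l<n. X k l * w' i l) = b * (ev j * v k)"
        unfolding True w'_def using veig[OF that(2)] by (simp add: sum_scale_right)
      then show ?thesis by (simp add: True w'_def mult.left_commute)
    next
      case False
      then show ?thesis using that weig by (simp add: w'_def)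
    qed
    moreover have "\<exists>y. (\<forall>l\<ge>Suc j. y l = 0) \<and> (\<forall>k<n. w' i k = (\<Sum>l<n. y l * c l k))" if "i < Suc j" for i
    proof (cases "i = j")
      case True
      then show ?thesis using x0 vx
        by (intro exI[of _ "\<lambda>l. b * x l"]) (simp add: w'_def mult.assoc sum_distrib_left)
    next
      case False
      then show ?thesis using that y0 yw
        by (intro exI[of _ "y i"]) (simp add: w'_def)
    qed
    ultimately show ?case by (intro exI[of _ w'] conjI allI impI) auto
  qed
  from this[of n] that show ?thesis by auto
qed

text \<open>The rank-two perturbation \<open>X = I - p u u\<^sup>T - r v v\<^sup>T\<close>. As a relation between entries it
connects a matrix with vectors given as functions, and leaves \<open>u\<close> and \<open>v\<close> free to be orthonormal
eigenvectors or merely the two rows of a Gram factorization.\<close>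
definition identity_minus :: "nat \<Rightarrow> real mat \<Rightarrow> real \<Rightarrow> (nat \<Rightarrow> real) \<Rightarrow> real \<Rightarrow> (nat \<Rightarrow> real) \<Rightarrow> bool" where
  "identity_minus n X p u r v \<longleftrightarrow> (\<forall>k<n. \<forall>l<n.
     X $$ (k, l) = (if k = l then 1 else 0) - p * (u k * u l) - r * (v k * v l))"

lemma spectral_sum_ones_pair:
  assumes w: "orthonormal n n w" and n: "2 \<le> n" and kl: "k < n" "l < n"
  shows "(\<Sum>i<n. w i k * ones_pair n s t $ i * w i l)
    = (if k = l then 1 else 0) - (1 - s) * (w (n - 2) k * w (n - 2) l)
        - (1 - t) * (w (n - 1) k * w (n - 1) l)"
proof -
  have "w i k * ones_pair n s t $ i * w i l = w i k * w i l
      - (if i = n - 2 then (1 - s) * (w i k * w i l) else 0)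
      - (if i = n - 1 then (1 - t) * (w i k * w i l) else 0)" if "i < n" for i
    using that n by (auto simp: ones_pair_def algebra_simps)
  then have "(\<Sum>i<n. w i k * ones_pair n s t $ i * w i l)
    = (\<Sum>i<n. w i k * w i l - (if i = n - 2 then (1 - s) * (w i k * w i l) else 0)
      - (if i = n - 1 then (1 - t) * (w i k * w i l) else 0))" by simp
  then show ?thesis
    using n orthonormal_rows_columns[OF w kl] by (simp add: sum_subtractf)
qed

text \<open>The columns of the similarity transformation are a basis of eigenvectors. After replacing it by an
orthonormal one, the spectral decomposition differs from that of \<open>I\<close> only in the last two
terms.\<close>
lemma similar_ones_pairE:
  assumes n: "2 \<le> n" and X: "X \<in> carrier_mat n n" "symmetric_mat X"
    and sim: "similar_mat X (diag_of_vec (ones_pair n s t))"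
  obtains u v where "orthonormal_pair n u v" "identity_minus n X (1 - s) u (1 - t) v"
proof -
  define D where "D = diag_of_vec (ones_pair n s t)"
  have D: "D = mat_diag n (\<lambda>i. ones_pair n s t $ i)" "D \<in> carrier_mat n n"
    by (simp_all add: D_def diag_of_vec_def ones_pair_def)
  obtain P Q where PQ: "P \<in> carrier_mat n n" "Q \<in> carrier_mat n n"
      "P * Q = 1\<^sub>m n" "Q * P = 1\<^sub>m n" "X = P * D * Q"
    using similar_matD[OF sim] X(1) unfolding D_def by (metis carrier_matD(1) insert_subset)
  have "X * P = P * D * (Q * P)" 
    using PQ(1,2) D(2) unfolding PQ(5) by (intro assoc_mult_mat) auto
  then have XP: "X * P = P * D" using PQ D(2) by simp
  have eigen: "(\<Sum>l<n. X $$ (k, l) * P $$ (l, i)) = ones_pair n s t $ i * P $$ (k, i)"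
    if "i < n" "k < n" for i k
  proof -
    have "(\<Sum>l<n. X $$ (k, l) * P $$ (l, i)) = (X * P) $$ (k, i)"
      using that X(1) PQ(1) by (simp add: scalar_prod_def lessThan_atLeast0)
    also have "\<dots> = P $$ (k, i) * ones_pair n s t $ i"
      using that PQ(1) by (simp add: XP D(1) mat_diag_mult_right)
    finally show ?thesis by (simp add: mult.commute)
  qed
  have indep: "\<forall>i<n. y i = 0" if y: "\<forall>k<n. (\<Sum>i<n. y i * P $$ (k, i)) = 0" for y
  proof -
    have "P *\<^sub>v vec n y = 0\<^sub>v n"
      using y PQ(1) by (intro eq_vecI) (simp_all add: scalar_prod_def lessThan_atLeast0 mult.commute)
    moreover have "Q *\<^sub>v 0\<^sub>v n = 0\<^sub>v n" using PQ(2) by (intro eq_vecI) auto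
    ultimately have "(Q * P) *\<^sub>v vec n y = 0\<^sub>v n"
      using assoc_mult_mat_vec[OF PQ(2,1), of "vec n y"] by simp
    then have "vec n y = 0\<^sub>v n" using PQ(4) by simp
    then show ?thesis by (metis index_vec index_zero_vec(1))
  qed
  have sym: "X $$ (k, l) = X $$ (l, k)" if "k < n" "l < n" for k l
    using X that unfolding symmetric_mat_def by (metis carrier_matD(2) index_transpose_mat(1))
  obtain w where w: "orthonormal n n w"
    and weig: "\<And>i k. i < n \<Longrightarrow> k < n \<Longrightarrow> (\<Sum>l<n. X $$ (k, l) * w i l) = ones_pair n s t $ i * w i k"
    using gram_schmidt_eigenvectors[of n "\<lambda>k l. X $$ (k, l)" "\<lambda>i k. P $$ (k, i)"
        "\<lambda>i. ones_pair n s t $ i", OF sym eigen indep] by blast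
  have "X $$ (l, k) = (\<Sum>i<n. w i k * ones_pair n s t $ i * w i l)" if kl: "k < n" "l < n" for k l
  proof -
    have "(\<Sum>i<n. w i k * ones_pair n s t $ i * w i l)
        = (\<Sum>i<n. w i k * (\<Sum>m<n. X $$ (l, m) * w i m))"
      using weig[OF _ kl(2)] by (simp add: mult.assoc)
    also have "\<dots> = (\<Sum>i<n. \<Sum>m<n. X $$ (l, m) * (w i k * w i m))"
      by (simp add: sum_distrib_left mult.left_commute)
    also have "\<dots> = (\<Sum>m<n. X $$ (l, m) * (\<Sum>i<n. w i k * w i m))"
      by (subst sum.swap) (simp add: sum_distrib_left)
    also have "\<dots> = (\<Sum>m<n. if k = m then X $$ (l, m) else 0)"
      using orthonormal_rows_columns[OF w kl(1)] by (intro sum.cong) auto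
    also have "\<dots> = X $$ (l, k)" using kl(1) by simp
    finally show ?thesis ..
  qed
  then have "identity_minus n X (1 - s) (w (n - 2)) (1 - t) (w (n - 1))"
    using spectral_sum_ones_pair[OF w n] by (simp add: identity_minus_def sym)
  moreover have "orthonormal_pair n (w (n - 2)) (w (n - 1))"
    using w n by (simp add: orthonormal_def orthonormal_pair_def)
  ultimately show ?thesis using that by blast
qed

text \<open>Completing \<open>v, u\<close> to an orthonormal basis and reading it backwards puts \<open>u\<close> and \<open>v\<close> in the last
two columns of an orthogonal matrix that diagonalizes \<open>X\<close>.\<close>
lemma similar_ones_pairI:
  assumes n: "2 \<le> n" and X: "X \<in> carrier_mat n n"
    and uv: "orthonormal_pair n u v" and id: "identity_minus n X (1 - s) u (1 - t) v"
  shows "similar_mat X (diag_of_vec (ones_pair n s t))"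
proof -
  have "orthonormal n 2 (\<lambda>i. if i = 0 then v else u)"
    using uv by (auto simp: orthonormal_def orthonormal_pair_def less_2_cases_iff mult.commute)
  then obtain w' where w': "orthonormal n n w'" "\<forall>i<2. w' i = (if i = 0 then v else u)"
    using orthonormal_extend[of 2 n n] n by blast
  define w where "w i = w' (n - 1 - i)" for i
  have w: "orthonormal n n w"
    using w'(1) unfolding orthonormal_def w_def by auto
  have w_uv: "w (n - 2) = u" "w (n - 1) = v"
    using n w'(2) by (simp_all add: w_def Suc_diff_Suc numeral_2_eq_2)
  define P where "P = mat n n (\<lambda>(k, i). w i k)"
  define D where "D = diag_of_vec (ones_pair n s t)"
  have D: "D = mat_diag n (\<lambda>i. ones_pair n s t $ i)" "D \<in> carrier_mat n n"
    by (simp_all add: D_def diag_of_vec_def ones_pair_def)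
  have P: "P \<in> carrier_mat n n" by (simp add: P_def)
  have PPt: "P * transpose_mat P = 1\<^sub>m n"
    using orthonormal_rows_columns[OF w]
    by (intro eq_matI) (auto simp: P_def scalar_prod_def lessThan_atLeast0)
  have PtP: "transpose_mat P * P = 1\<^sub>m n"
    using P PPt mat_mult_left_right_inverse[of P n "transpose_mat P"] by simp
  have "X = P * D * transpose_mat P"
  proof (rule eq_matI)
    fix k l assume kl: "k < dim_row (P * D * transpose_mat P)" "l < dim_col (P * D * transpose_mat P)"
    then have kl: "k < n" "l < n" using P by auto
    have "(P * D * transpose_mat P) $$ (k, l) = (\<Sum>i<n. w i k * ones_pair n s t $ i * w i l)"
      using kl P by (simp add: D(1) mat_diag_mult_right[OF P] scalar_prod_def lessThan_atLeast0)
        (simp add: P_def)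
    then show "X $$ (k, l) = (P * D * transpose_mat P) $$ (k, l)"
      using spectral_sum_ones_pair[OF w n kl] id kl w_uv by (simp add: identity_minus_def)
  qed (use X P in auto)
  then show ?thesis
    using P X D(2) PPt PtP unfolding D_def[symmetric]
    by (intro similar_matI[of _ _ P "transpose_mat P" n]) auto
qed

text \<open>The trace and the squared Frobenius norm of \<open>I - X\<close> are the power sums of the two
coefficients; together they determine the pair up to order.\<close>
lemma rank_two_invariants:
  assumes "orthonormal_pair n u v" "identity_minus n X p u r v"
  shows "(\<Sum>k<n. 1 - X $$ (k, k)) = p + r"
    and "(\<Sum>k<n. \<Sum>l<n. ((if k = l then 1 else 0) - X $$ (k, l))\<^sup>2) = p\<^sup>2 + r\<^sup>2"
proof -
  have uv: "(\<Sum>l<n. u l * u l) = 1" "(\<Sum>l<n. v l * v l) = 1" "(\<Sum>l<n. u l * v l) = 0"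
    using assms(1) by (simp_all add: orthonormal_pair_def)
  have "(\<Sum>k<n. 1 - X $$ (k, k)) = (\<Sum>k<n. p * (u k * u k) + r * (v k * v k))"
    using assms(2) by (simp add: identity_minus_def)
  also have "\<dots> = p + r" by (simp add: sum.distrib uv flip: sum_distrib_left)
  finally show "(\<Sum>k<n. 1 - X $$ (k, k)) = p + r" .
  have "(\<Sum>k<n. \<Sum>l<n. ((if k = l then 1 else 0) - X $$ (k, l))\<^sup>2)
      = (\<Sum>k<n. \<Sum>l<n. p\<^sup>2 * ((u k * u k) * (u l * u l)) + r\<^sup>2 * ((v k * v k) * (v l * v l))
          + 2 * p * r * ((u k * v k) * (u l * v l)))"
  proof (intro sum.cong refl)
    fix k l assume "k \<in> {..<n}" "l \<in> {..<n}"
    then have e: "(if k = l then 1 else 0) - X $$ (k, l) = p * (u k * u l) + r * (v k * v l)"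
      using assms(2) by (simp add: identity_minus_def)
    show "((if k = l then 1 else 0) - X $$ (k, l))\<^sup>2
        = p\<^sup>2 * ((u k * u k) * (u l * u l)) + r\<^sup>2 * ((v k * v k) * (v l * v l))
          + 2 * p * r * ((u k * v k) * (u l * v l))"
      unfolding e by (simp add: power2_eq_square algebra_simps)
  qed
  also have "\<dots> = p\<^sup>2 * ((\<Sum>k<n. u k * u k) * (\<Sum>l<n. u l * u l))
      + r\<^sup>2 * ((\<Sum>k<n. v k * v k) * (\<Sum>l<n. v l * v l))
      + 2 * p * r * ((\<Sum>k<n. u k * v k) * (\<Sum>l<n. u l * v l))"
    unfolding sum_product by (simp add: sum.distrib sum_distrib_left)
  finally show "(\<Sum>k<n. \<Sum>l<n. ((if k = l then 1 else 0) - X $$ (k, l))\<^sup>2) = p\<^sup>2 + r\<^sup>2"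
    by (simp add: uv)
qed

lemma rank_two_coefficients_unique:
  assumes "orthonormal_pair n u v" "identity_minus n X p u r v"
    and "orthonormal_pair n u' v'" "identity_minus n X p' u' r' v'"
  shows "p = p' \<and> r = r' \<or> p = r' \<and> r = p'"
proof -
  have s: "p + r = p' + r'" "p\<^sup>2 + r\<^sup>2 = p'\<^sup>2 + r'\<^sup>2"
    using rank_two_invariants[OF assms(1,2)] rank_two_invariants[OF assms(3,4)] by simp_all
  have "(p - p') * (p - r') = 0"
  proof -
    have r: "r = p' + r' - p" using s(1) by simp
    show ?thesis using s(2) unfolding r by (simp add: power2_eq_square algebra_simps)
  qed
  then show ?thesis using s(1) by auto
qed

section \<open>Local positive semidefiniteness of rank-two perturbations of the identity\<close>

text \<open>Quadratic forms of a principal submatrix are those of the whole matrix summed over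
\<open>S\<close>: the enumeration \<^term>\<open>pick S\<close> is a bijection from the row numbers of the submatrix to
\<open>S\<close>. This removes submatrices from all later arguments.\<close>
lemma psd_submatrix_iff:
  assumes X: "X \<in> carrier_mat n n" "symmetric_mat X" and S: "S \<subseteq> {..<n}"
  shows "psd_mat (submatrix X S S) \<longleftrightarrow>
    (\<forall>f. 0 \<le> (\<Sum>i\<in>S. \<Sum>j\<in>S. f i * f j * X $$ (i, j)))"
proof -
  define m where "m = card S"
  have [simp]: "finite S" using S finite_subset by blast
  have S_eq: "{i. i < n \<and> i \<in> S} = S" using S by auto
  have dim: "dim_row (submatrix X S S) = m" "dim_col (submatrix X S S) = m"
    using X by (simp_all add: dim_submatrix S_eq m_def)
  have idx: "submatrix X S S $$ (i, j) = X $$ (pick S i, pick S j)" if "i < m" "j < m" for i j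
    using X that by (intro submatrix_index) (simp_all add: S_eq m_def)
  have pick_less: "pick S i < n" if "i < m" for i
    using pick_in_set_le[of i S] that S by (auto simp: m_def)
  have inj: "inj_on (pick S) {..<m}"
    by (intro strict_mono_on_imp_inj_on strict_mono_onI) (auto simp: m_def intro: pick_mono_le)
  have bij: "bij_betw (pick S) {..<m} S"
    using inj by (rule bij_betw_imageI, intro card_subset_eq)
      (auto simp: pick_in_set_le m_def card_image[OF inj[unfolded m_def]])
  have Xsym: "X $$ (i, j) = X $$ (j, i)" if "i < n" "j < n" for i j
    using X that unfolding symmetric_mat_def by (metis carrier_matD(2) index_transpose_mat(1))
  have "transpose_mat (submatrix X S S) = submatrix X S S"
    by (rule eq_matI) (auto simp: dim idx pick_less intro: Xsym)
  then have symm: "symmetric_mat (submatrix X S S)"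
    unfolding symmetric_mat_def by (intro conjI carrier_matI) (simp_all only: dim)
  have quad: "v \<bullet> (submatrix X S S *\<^sub>v v) = (\<Sum>i\<in>S. \<Sum>j\<in>S. f i * f j * X $$ (i, j))"
    if v: "v \<in> carrier_vec m" and f: "\<And>i. i < m \<Longrightarrow> f (pick S i) = v $ i" for v f
  proof -
    have "v \<bullet> (submatrix X S S *\<^sub>v v)
        = (\<Sum>i<m. v $ i * (\<Sum>j<m. X $$ (pick S i, pick S j) * v $ j))"
      using carrier_vecD[OF v] by (simp add: scalar_prod_def dim idx lessThan_atLeast0)
    also have "\<dots> = (\<Sum>i<m. \<Sum>j<m. f (pick S i) * f (pick S j) * X $$ (pick S i, pick S j))"
      by (simp add: sum_distrib_left f mult_ac)
    also have "\<dots> = (\<Sum>i<m. \<Sum>j\<in>S. f (pick S i) * f j * X $$ (pick S i, j))"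
      by (intro sum.cong refl sum.reindex_bij_betw[OF bij])
    also have "\<dots> = (\<Sum>i\<in>S. \<Sum>j\<in>S. f i * f j * X $$ (i, j))"
      by (rule sum.reindex_bij_betw[OF bij])
    finally show ?thesis .
  qed
  show ?thesis
  proof
    assume psd: "psd_mat (submatrix X S S)"
    show "\<forall>f. 0 \<le> (\<Sum>i\<in>S. \<Sum>j\<in>S. f i * f j * X $$ (i, j))"
    proof
      fix f
      have "0 \<le> vec m (\<lambda>i. f (pick S i)) \<bullet> (submatrix X S S *\<^sub>v vec m (\<lambda>i. f (pick S i)))"
        using psd by (simp add: psd_mat_def dim)
      also have "\<dots> = (\<Sum>i\<in>S. \<Sum>j\<in>S. f i * f j * X $$ (i, j))"
        by (rule quad) auto
      finally show "0 \<le> (\<Sum>i\<in>S. \<Sum>j\<in>S. f i * f j * X $$ (i, j))" .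
    qed
  next
    assume nonneg: "\<forall>f. 0 \<le> (\<Sum>i\<in>S. \<Sum>j\<in>S. f i * f j * X $$ (i, j))"
    have "0 \<le> v \<bullet> (submatrix X S S *\<^sub>v v)" if v: "v \<in> carrier_vec m" for v
    proof -
      have "v \<bullet> (submatrix X S S *\<^sub>v v)
        = (\<Sum>i\<in>S. \<Sum>j\<in>S. v $ inv_into {..<m} (pick S) i * v $ inv_into {..<m} (pick S) j * X $$ (i, j))"
        by (rule quad[OF v]) (simp add: inv_into_f_f[OF inj])
      then show ?thesis using nonneg[rule_format, of "\<lambda>i. v $ inv_into {..<m} (pick S) i"] by simp
    qed
    then show "psd_mat (submatrix X S S)"
      using symm by (simp add: psd_mat_def dim)
  qed
qed

lemma quadratic_form_rank_two:
  fixes f u v :: "nat \<Rightarrow> real"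
  assumes "finite S"
    and X: "\<And>i j. i \<in> S \<Longrightarrow> j \<in> S \<Longrightarrow> X i j = (if i = j then 1 else 0) - p * (u i * u j) - r * (v i * v j)"
  shows "(\<Sum>i\<in>S. \<Sum>j\<in>S. f i * f j * X i j)
    = (\<Sum>i\<in>S. (f i)\<^sup>2) - p * (\<Sum>i\<in>S. f i * u i)\<^sup>2 - r * (\<Sum>i\<in>S. f i * v i)\<^sup>2"
proof -
  have "f i * f j * X i j = (if i = j then f i * f j else 0)
      - p * ((f i * u i) * (f j * u j)) - r * ((f i * v i) * (f j * v j))" if "i \<in> S" "j \<in> S" for i j
    by (simp add: X[OF that] algebra_simps)
  then have "(\<Sum>i\<in>S. \<Sum>j\<in>S. f i * f j * X i j)
      = (\<Sum>i\<in>S. \<Sum>j\<in>S. (if i = j then f i * f j else 0)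
          - p * ((f i * u i) * (f j * u j)) - r * ((f i * v i) * (f j * v j)))"
    by simp
  also have "\<dots> = (\<Sum>i\<in>S. f i * f i)
      - p * (\<Sum>i\<in>S. \<Sum>j\<in>S. (f i * u i) * (f j * u j))
      - r * (\<Sum>i\<in>S. \<Sum>j\<in>S. (f i * v i) * (f j * v j))"
    using assms(1) by (simp add: sum_subtractf sum_distrib_left)
  finally show ?thesis by (simp add: power2_eq_square sum_product)
qed

lemma symmetric_mat_identity_minus:
  assumes "X \<in> carrier_mat n n" "identity_minus n X p u r v"
  shows "symmetric_mat X"
  using assms unfolding symmetric_mat_def identity_minus_def
  by (auto intro!: eq_matI simp: mult.commute)

lemma locally_psd_rank_two_iff:
  assumes X: "X \<in> carrier_mat n n" and id: "identity_minus n X p u r v"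
  shows "X \<in> locally_psd n d \<longleftrightarrow> (\<forall>S\<in>subsets_of_size n d. \<forall>f.
    p * (\<Sum>i\<in>S. f i * u i)\<^sup>2 + r * (\<Sum>i\<in>S. f i * v i)\<^sup>2 \<le> (\<Sum>i\<in>S. (f i)\<^sup>2))"
proof -
  have symm: "symmetric_mat X" using X id by (rule symmetric_mat_identity_minus)
  have "psd_mat (submatrix X S S) \<longleftrightarrow> (\<forall>f.
    p * (\<Sum>i\<in>S. f i * u i)\<^sup>2 + r * (\<Sum>i\<in>S. f i * v i)\<^sup>2 \<le> (\<Sum>i\<in>S. (f i)\<^sup>2))"
    if "S \<in> subsets_of_size n d" for S
  proof -
    have S: "S \<subseteq> {..<n}" "finite S"
      using that by (auto simp: subsets_of_size_def intro: finite_subset)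
    have form: "(\<Sum>i\<in>S. \<Sum>j\<in>S. f i * f j * X $$ (i, j))
      = (\<Sum>i\<in>S. (f i)\<^sup>2) - p * (\<Sum>i\<in>S. f i * u i)\<^sup>2 - r * (\<Sum>i\<in>S. f i * v i)\<^sup>2" for f
      using S id by (intro quadratic_form_rank_two) (auto simp: identity_minus_def subset_eq)
    show ?thesis
      unfolding psd_submatrix_iff[OF X symm S(1)] form by (simp add: algebra_simps)
  qed
  then show ?thesis unfolding locally_psd_def using X symm by blast
qed

section \<open>Squares of complex numbers and the plane frame bound\<close>

text \<open>Multiplying all members of a family by \<open>e\<close> multiplies the sum \<open>w\<close> of their squares by
\<open>e\<^sup>2\<close>, so a common rotation makes this sum real and nonnegative.\<close>
lemma exists_square_rotation:
  obtains e where "cmod e = 1" "e\<^sup>2 * w = of_real (cmod w)"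
proof (cases "w = 0")
  case True
  then show ?thesis using that[of 1] by simp
next
  case False
  define e where "e = csqrt (of_real (cmod w) / w)"
  have "e\<^sup>2 = of_real (cmod w) / w" by (simp add: e_def)
  moreover from this have "(cmod e)\<^sup>2 = 1"
    using False by (metis norm_power norm_divide norm_of_real abs_norm_cancel divide_self norm_eq_zero)
  ultimately show ?thesis using that[of e] False
    by (simp add: abs_square_eq_1)
qed

lemma Re_square_half: "(Re x)\<^sup>2 = ((cmod x)\<^sup>2 + Re (x\<^sup>2)) / 2"
  unfolding cmod_power2 by (simp add: power2_eq_square)

lemma sum_Re_square:
  "(\<Sum>j\<in>S. (Re (c * \<zeta> j))\<^sup>2)
    = ((cmod c)\<^sup>2 * (\<Sum>j\<in>S. cmod ((\<zeta> j)\<^sup>2)) + Re (c\<^sup>2 * (\<Sum>j\<in>S. (\<zeta> j)\<^sup>2))) / 2"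
proof -
  have "(\<Sum>j\<in>S. (Re (c * \<zeta> j))\<^sup>2)
      = (\<Sum>j\<in>S. ((cmod c)\<^sup>2 * cmod ((\<zeta> j)\<^sup>2) + Re (c\<^sup>2 * (\<zeta> j)\<^sup>2)) / 2)"
    by (intro sum.cong refl, subst Re_square_half)
      (simp only: power_mult_distrib norm_mult norm_power)
  also have "\<dots> = ((\<Sum>j\<in>S. (cmod c)\<^sup>2 * cmod ((\<zeta> j)\<^sup>2)) + (\<Sum>j\<in>S. Re (c\<^sup>2 * (\<zeta> j)\<^sup>2))) / 2"
    by (simp only: sum.distrib flip: sum_divide_distrib)
  finally show ?thesis by (simp only: sum_distrib_left Re_sum)
qed

text \<open>The vectors \<open>x = Re \<zeta>\<close> and \<open>y = Im \<zeta>\<close> satisfy \<open>x x\<^sup>T + y y\<^sup>T \<le> I\<close> on \<open>S\<close> iff the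
largest eigenvalue of their Gram matrix is at most \<open>1\<close>. That eigenvalue is
\<open>(\<Sum>|\<zeta>\<^sub>j|\<^sup>2 + |\<Sum> \<zeta>\<^sub>j\<^sup>2|) / 2\<close>, because the
projections of all \<open>\<zeta>\<^sub>j\<close> onto the line through a unit \<open>c\<close> with conjugate \<open>c'\<close> have
total squared length \<open>\<Sum> (Re (c' \<zeta>\<^sub>j))\<^sup>2 = (\<Sum>|\<zeta>\<^sub>j|\<^sup>2 + Re (c'\<^sup>2 \<Sum> \<zeta>\<^sub>j\<^sup>2)) / 2\<close>
(\<open>sum_Re_square\<close>), which is maximal when the last term equals the modulus.\<close>
lemma frame_bound_iff:
  fixes \<zeta> :: "nat \<Rightarrow> complex"
  assumes "finite S"
  shows "(\<forall>f. (\<Sum>j\<in>S. f j * Re (\<zeta> j))\<^sup>2 + (\<Sum>j\<in>S. f j * Im (\<zeta> j))\<^sup>2 \<le> (\<Sum>j\<in>S. (f j)\<^sup>2))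
    \<longleftrightarrow> (\<Sum>j\<in>S. cmod ((\<zeta> j)\<^sup>2)) + cmod (\<Sum>j\<in>S. (\<zeta> j)\<^sup>2) \<le> 2"
    (is "?L \<longleftrightarrow> ?T + cmod ?W \<le> 2")
proof -
  define g where "g f = (\<Sum>j\<in>S. of_real (f j) * \<zeta> j)" for f
  have g: "(\<Sum>j\<in>S. f j * Re (\<zeta> j))\<^sup>2 + (\<Sum>j\<in>S. f j * Im (\<zeta> j))\<^sup>2 = (cmod (g f))\<^sup>2" for f
    by (simp add: g_def cmod_power2)
  have Re_g: "Re (c * g f) = (\<Sum>j\<in>S. f j * Re (c * \<zeta> j))" for c f
    unfolding g_def sum_distrib_left Re_sum
    by (intro sum.cong refl) (simp add: algebra_simps)
  show ?thesis
  proof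
    assume L: ?L
    obtain e where e: "cmod e = 1" "e\<^sup>2 * ?W = of_real (cmod ?W)"
      by (rule exists_square_rotation)
    \<comment> \<open>The test vector lists the projections onto the direction of largest extent; its squared norm is the largest eigenvalue \<open>lam\<close> of the Gram matrix.\<close>
    define f where "f j = Re (e * \<zeta> j)" for j
    define lam where "lam = (\<Sum>j\<in>S. (f j)\<^sup>2)"
    have lam: "lam = (?T + cmod ?W) / 2"
      unfolding lam_def f_def sum_Re_square e by simp
    have "lam = Re (e * g f)" unfolding Re_g by (simp add: lam_def f_def power2_eq_square)
    also have "\<dots> \<le> cmod (g f)"
      using complex_Re_le_cmod[of "e * g f"] e by (simp add: norm_mult)
    finally have "lam \<le> cmod (g f)" .
    moreover have "0 \<le> lam" by (simp add: lam_def sum_nonneg)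
    ultimately have "lam * lam \<le> (cmod (g f))\<^sup>2"
      by (metis power2_eq_square power_mono)
    also have "\<dots> \<le> lam * 1" using L g by (simp add: lam_def)
    finally have "lam \<le> 1" using \<open>0 \<le> lam\<close>
      by (cases "lam = 0") (auto dest: mult_left_le_imp_le)
    then show "?T + cmod ?W \<le> 2" using lam by simp
  next
    assume le: "?T + cmod ?W \<le> 2"
    have "(cmod (g f))\<^sup>2 \<le> (\<Sum>j\<in>S. (f j)\<^sup>2)" for f
    proof -
      let ?c = "cnj (g f)"
      have "(cmod (g f))\<^sup>2 = Re (?c * g f)"
        by (simp add: complex_norm_square[symmetric] mult.commute[of "cnj _"])
      also have "\<dots> = (\<Sum>j\<in>S. f j * Re (?c * \<zeta> j))" by (rule Re_g)
      finally have eq: "(cmod (g f))\<^sup>2 = (\<Sum>j\<in>S. f j * Re (?c * \<zeta> j))" .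
      have "(\<Sum>j\<in>S. (Re (?c * \<zeta> j))\<^sup>2) \<le> (cmod (g f))\<^sup>2"
      proof -
        have "Re (?c\<^sup>2 * ?W) \<le> (cmod (g f))\<^sup>2 * cmod ?W"
          using complex_Re_le_cmod[of "?c\<^sup>2 * ?W"] by (simp add: norm_mult norm_power)
        then have "(\<Sum>j\<in>S. (Re (?c * \<zeta> j))\<^sup>2) \<le> (cmod (g f))\<^sup>2 * ((?T + cmod ?W) / 2)"
          unfolding sum_Re_square by (simp add: algebra_simps)
        also have "\<dots> \<le> (cmod (g f))\<^sup>2 * 1" using le by (intro mult_left_mono) auto
        finally show ?thesis by simp
      qed
      \<comment> \<open>The projections have squared norm at most \<open>|g f|\<^sup>2\<close> and inner product \<open>|g f|\<^sup>2\<close> with \<open>f\<close>, so expanding this square bounds \<open>|g f|\<^sup>2\<close> by the squared norm of \<open>f\<close>.\<close>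
      moreover have "0 \<le> (\<Sum>j\<in>S. (f j - Re (?c * \<zeta> j))\<^sup>2)" by (rule sum_nonneg) simp
      moreover have "(\<Sum>j\<in>S. (f j - Re (?c * \<zeta> j))\<^sup>2)
          = (\<Sum>j\<in>S. (f j)\<^sup>2) - 2 * (cmod (g f))\<^sup>2 + (\<Sum>j\<in>S. (Re (?c * \<zeta> j))\<^sup>2)"
        unfolding eq power2_diff
        by (simp only: sum.distrib sum_subtractf sum_distrib_left mult.assoc)
      ultimately show ?thesis by linarith
    qed
    then show ?L unfolding g by simp
  qed
qed

text \<open>The dictionary between the two optimization problems, valid for nonnegative coefficients only: a
negative one has no real square root to be absorbed into the vectors.\<close>
lemma locally_psd_complex_iff:
  assumes X: "X \<in> carrier_mat n n" and id: "identity_minus n X p u r v" and pr: "0 \<le> p" "0 \<le> r"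
    and \<zeta>: "\<And>j. j < n \<Longrightarrow> \<zeta> j = (Complex (sqrt p * u j) (sqrt r * v j))\<^sup>2"
  shows "X \<in> locally_psd n d \<longleftrightarrow>
    (\<forall>S\<in>subsets_of_size n d. (\<Sum>j\<in>S. cmod (\<zeta> j)) + cmod (\<Sum>j\<in>S. \<zeta> j) \<le> 2)"
  unfolding locally_psd_rank_two_iff[OF X id]
proof (intro ball_cong refl)
  fix S assume "S \<in> subsets_of_size n d"
  then have S: "finite S" "S \<subseteq> {..<n}" by (auto simp: subsets_of_size_def intro: finite_subset)
  let ?c = "\<lambda>j. Complex (sqrt p * u j) (sqrt r * v j)"
  have scale: "q * (\<Sum>i\<in>S. f i * x i)\<^sup>2 = (\<Sum>i\<in>S. f i * (sqrt q * x i))\<^sup>2"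
    if "0 \<le> q" for q :: real and f x :: "nat \<Rightarrow> real"
    using that by (simp add: sum_scale_right power_mult_distrib)
  have "(\<Sum>j\<in>S. cmod (\<zeta> j)) = (\<Sum>j\<in>S. cmod ((?c j)\<^sup>2))" "(\<Sum>j\<in>S. \<zeta> j) = (\<Sum>j\<in>S. (?c j)\<^sup>2)"
    using S(2) \<zeta> by (auto intro!: sum.cong)
  then show "(\<forall>f. p * (\<Sum>i\<in>S. f i * u i)\<^sup>2 + r * (\<Sum>i\<in>S. f i * v i)\<^sup>2 \<le> (\<Sum>i\<in>S. (f i)\<^sup>2))
      = ((\<Sum>j\<in>S. cmod (\<zeta> j)) + cmod (\<Sum>j\<in>S. \<zeta> j) \<le> 2)"
    using frame_bound_iff[OF S(1), of ?c] by (simp only: scale[OF pr(1)] scale[OF pr(2)] complex.sel)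
qed

section \<open>Existence of minimizers of the complex problem\<close>

lemma finite_subsets_of_size [simp]: "finite (subsets_of_size n d)"
  by (rule finite_subset[of _ "Pow {..<n}"]) (auto simp: subsets_of_size_def)

lemma subsets_of_size_member:
  assumes "k < n" "1 \<le> d" "d \<le> n"
  obtains S where "S \<in> subsets_of_size n d" "k \<in> S"
proof -
  have "d - 1 \<le> card ({..<n} - {k})" using assms by simp
  then obtain T where T: "T \<subseteq> {..<n} - {k}" "card T = d - 1" "finite T"
    by (rule obtain_subset_with_card_n)
  then have "insert k T \<in> subsets_of_size n d"
    using assms by (auto simp: subsets_of_size_def card_insert_if)
  then show ?thesis using that by blast
qed

lemma max_objective_le_iff:
  assumes "d \<le> n"
  shows "max_objective n d z \<le> m \<longleftrightarrow>
    (\<forall>S\<in>subsets_of_size n d. (\<Sum>s\<in>S. cmod (z $ s)) + cmod (\<Sum>s\<in>S. z $ s) \<le> m)"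
proof -
  have "{..<d} \<in> subsets_of_size n d" using assms by (auto simp: subsets_of_size_def)
  then have "subsets_of_size n d \<noteq> {}" by blast
  then show ?thesis unfolding max_objective_def by (subst Max_le_iff) auto
qed

lemma max_objective_pos:
  assumes z: "z \<in> mu_max_feasible n" and d: "1 \<le> d" "d \<le> n"
  shows "0 < max_objective n d z"
proof -
  have "(\<Sum>k<n. cmod (z $ k)) = 1" using z by (simp add: mu_max_feasible_def)
  then obtain k where k: "k < n" "z $ k \<noteq> 0"
    by (metis lessThan_iff norm_zero sum.neutral zero_neq_one)
  then obtain S where S: "S \<in> subsets_of_size n d" "k \<in> S"
    using subsets_of_size_member d by blast
  then have "finite S" by (auto simp: subsets_of_size_def intro: finite_subset)
  have "0 < cmod (z $ k)" using k by simp
  also have "\<dots> \<le> (\<Sum>s\<in>S. cmod (z $ s))"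
    using S \<open>finite S\<close> by (intro member_le_sum) auto
  also have "\<dots> \<le> (\<Sum>s\<in>S. cmod (z $ s)) + cmod (\<Sum>s\<in>S. z $ s)" by simp
  also have "\<dots> \<le> max_objective n d z"
    using max_objective_le_iff[OF d(2), of z "max_objective n d z"] S(1) by simp
  finally show ?thesis .
qed

lemma pi_feasible_subset: "pi_max_feasible n \<subseteq> mu_max_feasible n"
  by (auto simp: pi_max_feasible_def mu_max_feasible_def)

lemma continuous_on_Max:
  fixes g :: "'i \<Rightarrow> 'a::topological_space \<Rightarrow> real"
  assumes "finite F" "F \<noteq> {}" "\<And>i. i \<in> F \<Longrightarrow> continuous_on A (g i)"
  shows "continuous_on A (\<lambda>x. Max ((\<lambda>i. g i x) ` F))"
  using assms
proof (induction F rule: finite_ne_induct)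
  case (insert i F)
  then show ?case by (auto intro!: continuous_on_max)
qed auto

text \<open>The two feasible sets are handled together by the flag \<open>zero_sum\<close>. They are images of compact
sets of functions into \<open>\<real> \<times> \<real>\<close> under the product topology; coordinates beyond \<open>n\<close> are pinned to
\<open>0\<close> so that Tychonoff's theorem applies to the product of the bounding squares.\<close>
lemma max_objective_attains_min:
  fixes n d :: nat and zero_sum :: bool
  defines "feasible \<equiv> {z \<in> carrier_vec n. (\<Sum>k<n. cmod (z $ k)) = 1 \<and> (zero_sum \<longrightarrow> (\<Sum>k<n. z $ k) = 0)}"
  assumes d: "d \<le> n" and nonempty: "feasible \<noteq> {}"
  shows "\<exists>m. is_minimum m (max_objective n d ` feasible)"
proof -
  define c where "c f k = Complex (fst (f k)) (snd (f k))" for f :: "nat \<Rightarrow> real \<times> real" and k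
  define Z where "Z f = vec n (c f)" for f
  define B :: "nat \<Rightarrow> (real \<times> real) set" where
    "B k = (if k < n then {-1..1} \<times> {-1..1} else {0})" for k
  have cont_c: "continuous_on UNIV (\<lambda>f. c f k)" for k
    unfolding c_def Complex_eq
    by (intro continuous_intros continuous_on_product_coordinates)
  have "compactin (product_topology (\<lambda>_. euclidean) UNIV) (Pi\<^sub>E UNIV B)"
    unfolding compactin_PiE by (auto simp: B_def intro!: compact_Times)
  then have "compact (Pi\<^sub>E UNIV B)"
    by (simp add: euclidean_product_topology)
  moreover have "closed {f. (\<Sum>k<n. cmod (c f k)) = 1}"
    by (intro closed_Collect_eq continuous_intros cont_c)
  moreover have "closed {f. zero_sum \<longrightarrow> (\<Sum>k<n. c f k) = 0}"
    by (cases zero_sum) (simp_all add: closed_Collect_eq continuous_on_sum cont_c)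
  moreover define K where "K = Pi\<^sub>E UNIV B \<inter> {f. (\<Sum>k<n. cmod (c f k)) = 1}
      \<inter> {f. zero_sum \<longrightarrow> (\<Sum>k<n. c f k) = 0}"
  ultimately have "compact K"
    by (simp add: compact_Int_closed)
  have Z_K: "Z ` K = feasible"
  proof (intro equalityI subsetI)
    fix z assume "z \<in> Z ` K"
    then show "z \<in> feasible" by (auto simp: K_def feasible_def Z_def)
  next
    fix z assume z: "z \<in> feasible"
    define f where "f k = (if k < n then (Re (z $ k), Im (z $ k)) else 0)" for k
    have cf: "c f k = z $ k" if "k < n" for k using that by (simp add: c_def f_def)
    have le: "cmod (z $ k) \<le> 1" if "k < n" for k
    proof -
      have "cmod (z $ k) \<le> (\<Sum>k<n. cmod (z $ k))" using that by (intro member_le_sum) auto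
      then show ?thesis using z by (simp add: feasible_def)
    qed
    have "f k \<in> B k" for k
      using abs_Re_le_cmod[of "z $ k"] abs_Im_le_cmod[of "z $ k"] le[of k]
      by (auto simp: f_def B_def abs_le_iff)
    then have "f \<in> K" using z by (auto simp: K_def cf feasible_def)
    moreover have "z = Z f" using z by (intro eq_vecI) (auto simp: Z_def cf feasible_def)
    ultimately show "z \<in> Z ` K" by blast
  qed
  have "continuous_on UNIV (\<lambda>f. Max ((\<lambda>S. (\<Sum>s\<in>S. cmod (c f s)) + cmod (\<Sum>s\<in>S. c f s)) ` subsets_of_size n d))"
    using d by (intro continuous_on_Max continuous_intros cont_c) (auto simp: subsets_of_size_def intro!: exI[of _ "{..<d}"])
  also have "(\<lambda>f. Max ((\<lambda>S. (\<Sum>s\<in>S. cmod (c f s)) + cmod (\<Sum>s\<in>S. c f s)) ` subsets_of_size n d))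
      = (\<lambda>f. max_objective n d (Z f))"
    unfolding max_objective_def
    by (intro ext arg_cong[of _ _ Max] image_cong refl)
      (auto simp: Z_def subsets_of_size_def subset_eq intro!: arg_cong2[of _ _ _ _ "(+)"] arg_cong[of _ _ cmod] sum.cong)
  finally have "continuous_on K (\<lambda>f. max_objective n d (Z f))"
    by (rule continuous_on_subset) simp
  moreover have "K \<noteq> {}" using Z_K nonempty by blast
  ultimately obtain f where "f \<in> K" "\<forall>g\<in>K. max_objective n d (Z f) \<le> max_objective n d (Z g)"
    using continuous_attains_inf[OF \<open>compact K\<close>] by blast
  then have "is_minimum (max_objective n d (Z f)) (max_objective n d ` Z ` K)"
    by (auto simp: is_minimum_def)
  then show ?thesis unfolding Z_K by blast
qed

lemma is_minimum_LEAST: "is_minimum m V \<Longrightarrow> (LEAST x. x \<in> V) = m"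
  unfolding is_minimum_def by (intro Least_equality) auto

text \<open>This point shows that neither feasible set is empty.\<close>
lemma alternating_feasible:
  assumes "2 \<le> n"
  shows "vec n (\<lambda>k. if k = 0 then 1 / 2 else if k = 1 then - 1 / 2 else 0) \<in> pi_max_feasible n"
proof -
  have n: "{..<n} = insert 0 (insert 1 {2..<n})" using assms by auto
  have "0 < n" "Suc 0 < n" using assms by auto
  then show ?thesis unfolding pi_max_feasible_def by (auto simp: n)
qed

lemma is_minimum_mu_max:
  assumes "2 \<le> n" "d \<le> n"
  shows "is_minimum (mu_max n d) (max_objective n d ` mu_max_feasible n)"
proof -
  have "mu_max_feasible n \<noteq> {}"
    using alternating_feasible[OF assms(1)] pi_feasible_subset[of n] by blast
  then obtain m where "is_minimum m (max_objective n d ` mu_max_feasible n)"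
    using max_objective_attains_min[OF assms(2), where zero_sum = False]
    by (auto simp: mu_max_feasible_def)
  then show ?thesis unfolding mu_max_def by (simp add: is_minimum_LEAST)
qed

lemma is_minimum_pi_max:
  assumes "2 \<le> n" "d \<le> n"
  shows "is_minimum (pi_max n d) (max_objective n d ` pi_max_feasible n)"
proof -
  have "pi_max_feasible n \<noteq> {}"
    using alternating_feasible[OF assms(1)] by blast
  then obtain m where "is_minimum m (max_objective n d ` pi_max_feasible n)"
    using max_objective_attains_min[OF assms(2), where zero_sum = True]
    by (auto simp: pi_max_feasible_def)
  then show ?thesis unfolding pi_max_def by (simp add: is_minimum_LEAST)
qed

section \<open>From matrices to feasible points\<close>

text \<open>Positive semidefiniteness bounds the objective by the constant \<open>2\<close> and leaves the total \<open>T\<close> free,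
whereas the complex problem fixes the total and minimizes the objective. Homogeneity converts one
normalization into the other.\<close>
lemma scaled_feasible:
  assumes d: "d \<le> n" and T: "(\<Sum>k<n. cmod (\<zeta> k)) = T" "0 < T"
    and bound: "\<And>S. S \<in> subsets_of_size n d \<Longrightarrow> (\<Sum>j\<in>S. cmod (\<zeta> j)) + cmod (\<Sum>j\<in>S. \<zeta> j) \<le> 2"
  defines "z \<equiv> vec n (\<lambda>k. \<zeta> k / of_real T)"
  shows "z \<in> mu_max_feasible n" "max_objective n d z \<le> 2 / T"
    "(\<Sum>k<n. \<zeta> k) = 0 \<Longrightarrow> z \<in> pi_max_feasible n"
proof -
  show z: "z \<in> mu_max_feasible n"
    using T by (simp add: z_def mu_max_feasible_def norm_divide flip: sum_divide_distrib)
  show "max_objective n d z \<le> 2 / T"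
    unfolding max_objective_le_iff[OF d]
  proof
    fix S assume S: "S \<in> subsets_of_size n d"
    then have idx: "z $ s = \<zeta> s / of_real T" if "s \<in> S" for s
      using that by (auto simp: z_def subsets_of_size_def)
    have "(\<Sum>s\<in>S. cmod (z $ s)) + cmod (\<Sum>s\<in>S. z $ s)
        = ((\<Sum>j\<in>S. cmod (\<zeta> j)) + cmod (\<Sum>j\<in>S. \<zeta> j)) / T"
      using T(2) by (simp add: idx norm_divide add_divide_distrib flip: sum_divide_distrib)
    then show "(\<Sum>s\<in>S. cmod (z $ s)) + cmod (\<Sum>s\<in>S. z $ s) \<le> 2 / T"
      using bound[OF S] T(2) by (simp add: divide_right_mono)
  qed
  show "z \<in> pi_max_feasible n" if "(\<Sum>k<n. \<zeta> k) = 0"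
    using that z by (simp add: z_def pi_max_feasible_def mu_max_feasible_def flip: sum_divide_distrib)
qed

text \<open>The total of \<open>\<zeta>\<^sub>j = (\<surd>p u\<^sub>j + \<i> \<surd>r v\<^sub>j)\<^sup>2\<close> is \<open>p + r\<close> because \<open>u\<close> and \<open>v\<close> are unit vectors;
for \<open>p = r\<close> orthonormality also makes their sum vanish.\<close>
lemma feasible_of_semidefinite:
  assumes d: "d \<le> n" and X: "X \<in> locally_psd n d"
    and on: "orthonormal_pair n u v" and id: "identity_minus n X p u r v"
    and pr: "0 \<le> p" "0 \<le> r" "0 < p + r"
  obtains z where "z \<in> mu_max_feasible n" "max_objective n d z \<le> 2 / (p + r)"
    "p = r \<Longrightarrow> z \<in> pi_max_feasible n"
proof -
  define \<zeta> where "\<zeta> j = (Complex (sqrt p * u j) (sqrt r * v j))\<^sup>2" for j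
  have uv: "(\<Sum>l<n. u l * u l) = 1" "(\<Sum>l<n. v l * v l) = 1" "(\<Sum>l<n. u l * v l) = 0"
    using on by (simp_all add: orthonormal_pair_def)
  have "cmod (\<zeta> j) = p * (u j * u j) + r * (v j * v j)" for j
    unfolding \<zeta>_def norm_power cmod_power2
    using pr by (simp add: power_mult_distrib power2_eq_square[of "u j"] power2_eq_square[of "v j"])
  then have T: "(\<Sum>k<n. cmod (\<zeta> k)) = p + r"
    by (simp add: sum.distrib uv flip: sum_distrib_left)
  have zero: "(\<Sum>k<n. \<zeta> k) = 0" if "p = r"
  proof -
    have "\<zeta> j = of_real p * Complex (u j * u j - v j * v j) (2 * (u j * v j))" for j
      unfolding \<zeta>_def using pr(1) that
      by (simp add: complex_eq_iff power2_eq_square algebra_simps)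
        (simp flip: power2_eq_square mult.assoc)
    then have "(\<Sum>k<n. \<zeta> k) = of_real p * (\<Sum>k<n. Complex (u k * u k - v k * v k) (2 * (u k * v k)))"
      by (simp add: sum_distrib_left)
    also have "(\<Sum>k<n. Complex (u k * u k - v k * v k) (2 * (u k * v k))) = 0"
      by (simp add: complex_eq_iff sum_subtractf uv flip: sum_distrib_left)
    finally show ?thesis by simp
  qed
  have carr: "X \<in> carrier_mat n n" using X by (simp add: locally_psd_def)
  have "(\<Sum>j\<in>S. cmod (\<zeta> j)) + cmod (\<Sum>j\<in>S. \<zeta> j) \<le> 2" if "S \<in> subsets_of_size n d" for S
    using X locally_psd_complex_iff[OF carr id pr(1,2) \<zeta>_def] that by blast
  from scaled_feasible[OF d T pr(3) this] zero that show ?thesis by blast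
qed

lemma sum_Cauchy_Schwarz:
  fixes f g :: "nat \<Rightarrow> real"
  shows "(\<Sum>i\<in>A. f i * g i)\<^sup>2 \<le> (\<Sum>i\<in>A. (f i)\<^sup>2) * (\<Sum>i\<in>A. (g i)\<^sup>2)"
proof -
  have "\<bar>\<Sum>i\<in>A. f i * g i\<bar> \<le> (\<Sum>i\<in>A. \<bar>f i\<bar> * \<bar>g i\<bar>)"
    using sum_abs[of "\<lambda>i. f i * g i" A] by (simp add: abs_mult)
  also have "\<dots> \<le> L2_set f A * L2_set g A" by (rule L2_set_mult_ineq)
  finally have "(\<Sum>i\<in>A. f i * g i)\<^sup>2 \<le> (L2_set f A * L2_set g A)\<^sup>2"
    by (simp add: abs_le_square_iff[symmetric] L2_set_nonneg)
  then show ?thesis by (simp add: L2_set_def power_mult_distrib sum_nonneg)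
qed

text \<open>For \<open>r \<le> 0\<close> let \<open>B = I - X = p u u\<^sup>T + r v v\<^sup>T\<close> and let \<open>S'\<close> consist of the indices in
\<open>S\<close> with positive diagonal entry. On \<open>S'\<close> the matrix \<open>B\<close> has at most one positive eigenvalue,
and positive semidefiniteness bounds it by \<open>1\<close>; hence its trace there, the sum of the positive
parts of the diagonal over \<open>S\<close>, is at most \<open>1\<close>. So these positive parts form a feasible
family of real numbers whose total is at least the full trace \<open>p + r\<close>.\<close>
lemma feasible_of_indefinite:
  assumes d: "d \<le> n" and X: "X \<in> locally_psd n d"
    and on: "orthonormal_pair n u v" and id: "identity_minus n X p u r v"
    and pr: "r \<le> 0" "0 < p + r"
  obtains z where "z \<in> mu_max_feasible n" "max_objective n d z \<le> 2 / (p + r)"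
proof -
  define b where "b k = p * (u k * u k) + r * (v k * v k)" for k
  define T where "T = (\<Sum>k<n. max 0 (b k))"
  have carr: "X \<in> carrier_mat n n" using X by (simp add: locally_psd_def)
  have "p + r = (\<Sum>k<n. b k)"
    using on by (simp add: b_def orthonormal_pair_def sum.distrib flip: sum_distrib_left)
  also have "\<dots> \<le> T" unfolding T_def by (intro sum_mono) simp
  finally have T: "p + r \<le> T" "0 < T" using pr by simp_all
  have bound: "(\<Sum>k\<in>S. max 0 (b k)) \<le> 1" if S: "S \<in> subsets_of_size n d" for S
  proof -
    have "finite S" using S by (auto simp: subsets_of_size_def intro: finite_subset)
    define S' where "S' = {k \<in> S. 0 < b k}"
    define U where "U = (\<Sum>k\<in>S'. (u k)\<^sup>2)"
    define V where "V = (\<Sum>k\<in>S'. (v k)\<^sup>2)"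
    define W where "W = (\<Sum>k\<in>S'. u k * v k)"
    have restrict: "(\<Sum>k\<in>S. (if 0 < b k then g k else 0)) = (\<Sum>k\<in>S'. g k)" for g :: "nat \<Rightarrow> real"
      unfolding S'_def using \<open>finite S\<close> by (simp add: sum.inter_filter)
    have eq: "(\<Sum>k\<in>S. max 0 (b k)) = p * U + r * V"
    proof -
      have "(\<Sum>k\<in>S. max 0 (b k)) = (\<Sum>k\<in>S. (if 0 < b k then b k else 0))"
        by (intro sum.cong) auto
      also have "\<dots> = p * U + r * V"
        unfolding restrict U_def V_def by (simp add: b_def sum.distrib power2_eq_square sum_distrib_left)
      finally show ?thesis .
    qed
    \<comment> \<open>Testing with \<open>u\<close> restricted to \<open>S'\<close> and the Cauchy-Schwarz inequality replace the eigenvalue argument.\<close>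
    let ?f = "\<lambda>k. if 0 < b k then u k else 0"
    have "p * (\<Sum>k\<in>S. ?f k * u k)\<^sup>2 + r * (\<Sum>k\<in>S. ?f k * v k)\<^sup>2 \<le> (\<Sum>k\<in>S. (?f k)\<^sup>2)"
      using X[unfolded locally_psd_rank_two_iff[OF carr id], rule_format, OF S, of ?f] .
    also have "(\<Sum>k\<in>S. ?f k * u k) = U"
      using restrict[of "\<lambda>k. u k * u k"] by (simp add: U_def power2_eq_square if_distrib[of "\<lambda>x. x * _"] cong: if_cong)
    also have "(\<Sum>k\<in>S. ?f k * v k) = W"
      using restrict[of "\<lambda>k. u k * v k"] by (simp add: W_def if_distrib[of "\<lambda>x. x * _"] cong: if_cong)
    also have "(\<Sum>k\<in>S. (?f k)\<^sup>2) = U"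
      using restrict[of "\<lambda>k. (u k)\<^sup>2"] by (simp add: U_def if_distrib[of "\<lambda>x. x\<^sup>2"] cong: if_cong)
    finally have le: "p * U\<^sup>2 + r * W\<^sup>2 \<le> U" .
    have "W\<^sup>2 \<le> U * V" unfolding U_def V_def W_def by (rule sum_Cauchy_Schwarz)
    then have "r * (U * V) \<le> r * W\<^sup>2" using pr(1) by (rule mult_left_mono_neg)
    then have "U * (p * U + r * V) \<le> U * 1" using le by (simp add: algebra_simps power2_eq_square)
    moreover have "0 \<le> U" "0 \<le> V" by (simp_all add: U_def V_def sum_nonneg)
    ultimately have "p * U + r * V \<le> 1"
    proof (cases "U = 0")
      case True
      then show ?thesis using pr(1) \<open>0 \<le> V\<close> mult_nonpos_nonneg[of r V] by simp
    qed (auto dest: mult_left_le_imp_le)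
    then show ?thesis using eq by simp
  qed
  let ?\<zeta> = "\<lambda>k. complex_of_real (max 0 (b k))"
  have "(\<Sum>k<n. cmod (?\<zeta> k)) = T" by (simp add: T_def)
  moreover have "(\<Sum>k\<in>S. cmod (?\<zeta> k)) + cmod (\<Sum>k\<in>S. ?\<zeta> k) \<le> 2" if "S \<in> subsets_of_size n d" for S
  proof -
    have "cmod (\<Sum>k\<in>S. ?\<zeta> k) \<le> (\<Sum>k\<in>S. cmod (?\<zeta> k))" by (rule norm_sum)
    then show ?thesis using bound[OF that] by simp
  qed
  ultimately obtain z where z: "z \<in> mu_max_feasible n" "max_objective n d z \<le> 2 / T"
    using scaled_feasible[OF d _ T(2), of ?\<zeta>] by blast
  have "2 / T \<le> 2 / (p + r)" using T(1) pr by (intro divide_left_mono) auto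
  then show ?thesis using that z by auto
qed

lemma feasible_of_locally_psd:
  assumes d: "d \<le> n" and X: "X \<in> locally_psd n d"
    and on: "orthonormal_pair n u v" and id: "identity_minus n X p u r v"
    and pr: "0 < p + r"
  obtains z where "z \<in> mu_max_feasible n" "max_objective n d z \<le> 2 / (p + r)"
proof (cases "r \<le> 0")
  case True
  then show ?thesis using feasible_of_indefinite[OF d X on id _ pr] that by blast
next
  case r: False
  show ?thesis
  proof (cases "p \<le> 0")
    case True
    have "orthonormal_pair n v u" using on by (auto simp: orthonormal_pair_def mult.commute)
    moreover have "identity_minus n X r v p u" using id by (auto simp: identity_minus_def)
    ultimately obtain z where "z \<in> mu_max_feasible n" "max_objective n d z \<le> 2 / (r + p)"
      using feasible_of_indefinite[OF d X] True pr by (metis add.commute)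
    then show ?thesis using that by (simp add: add.commute)
  next
    case False
    then show ?thesis using feasible_of_semidefinite[OF d X on id] r pr that by force
  qed
qed

section \<open>From feasible points to matrices\<close>

text \<open>Multiplying the square roots \<open>\<zeta>\<^sub>k\<close> by a common unit \<open>e\<close> rotates all columns of the \<open>2 \<times> n\<close>
matrix of their coordinates and leaves its Gram matrix unchanged. The unit with
\<open>e\<^sup>2 \<Sum> z\<^sub>k = |\<Sum> z\<^sub>k|\<close> makes the two rows orthogonal, so that they diagonalize the
Gram matrix.\<close>
lemma feasible_diagonalization:
  assumes n: "2 \<le> n" and z: "z \<in> mu_max_feasible n"
    and \<zeta>: "\<And>k. k < n \<Longrightarrow> (\<zeta> k)\<^sup>2 = z $ k"
    and X: "identity_minus n X (2 / m) (\<lambda>k. Re (\<zeta> k)) (2 / m) (\<lambda>k. Im (\<zeta> k))"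
  obtains u v where "orthonormal_pair n u v"
    "identity_minus n X ((1 - cmod (\<Sum>k<n. z $ k)) / m) u
       ((1 + cmod (\<Sum>k<n. z $ k)) / m) v"
proof -
  define c where "c = 2 / m"
  define W where "W = (\<Sum>k<n. z $ k)"
  have sum_abs: "(\<Sum>k<n. cmod ((\<zeta> k)\<^sup>2)) = 1"
    using z \<zeta> by (simp add: mu_max_feasible_def)
  have sum_sq: "(\<Sum>k<n. (\<zeta> k)\<^sup>2) = W" using \<zeta> by (simp add: W_def)
  have "cmod W \<le> 1" unfolding sum_sq[symmetric] sum_abs[symmetric] by (rule norm_sum)
  obtain e where e: "cmod e = 1" "e\<^sup>2 * W = of_real (cmod W)" by (rule exists_square_rotation)
  define x where "x k = Re (e * \<zeta> k)" for k
  define y where "y k = Im (e * \<zeta> k)" for k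
  \<comment> \<open>The rows \<open>x\<close> and \<open>y\<close> of the rotated matrix satisfy \<open>\<Sum> (x\<^sub>k + \<i> y\<^sub>k)\<^sup>2 = |W|\<close> and have total squared length \<open>1\<close>.\<close>
  have xx: "(\<Sum>k<n. x k * x k) = (1 + cmod W) / 2"
    using sum_Re_square[where S = "{..<n}" and c = e and \<zeta> = \<zeta>] unfolding sum_abs sum_sq e
    by (simp add: x_def power2_eq_square del: times_complex.sel)
  have "(\<Sum>k<n. x k * x k + y k * y k) = (\<Sum>k<n. cmod ((\<zeta> k)\<^sup>2))"
  proof (intro sum.cong refl)
    fix k
    have "x k * x k + y k * y k = (cmod (e * \<zeta> k))\<^sup>2"
      by (simp only: x_def y_def cmod_power2 flip: power2_eq_square)
    then show "x k * x k + y k * y k = cmod ((\<zeta> k)\<^sup>2)"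
      by (simp add: norm_mult norm_power e)
  qed
  then have yy: "(\<Sum>k<n. y k * y k) = (1 - cmod W) / 2"
    unfolding sum_abs sum.distrib xx by (simp add: field_simps)
  have "2 * (\<Sum>k<n. x k * y k) = Im (\<Sum>k<n. (e * \<zeta> k)\<^sup>2)"
    unfolding Im_sum sum_distrib_left x_def y_def
    by (intro sum.cong refl) (simp add: power2_eq_square algebra_simps)
  also have "(\<Sum>k<n. (e * \<zeta> k)\<^sup>2) = of_real (cmod W)"
    unfolding power_mult_distrib sum_distrib_left[symmetric] sum_sq by (rule e)
  finally have xy: "(\<Sum>k<n. x k * y k) = 0" by simp
  have rot: "Re (\<zeta> k) * Re (\<zeta> l) + Im (\<zeta> k) * Im (\<zeta> l) = x k * x l + y k * y l" for k l
  proof -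
    have "(Re e)\<^sup>2 + (Im e)\<^sup>2 = 1" using e(1) by (metis cmod_power2 one_power2)
    then have "Re (\<zeta> k) * Re (\<zeta> l) + Im (\<zeta> k) * Im (\<zeta> l)
        = ((Re e)\<^sup>2 + (Im e)\<^sup>2) * (Re (\<zeta> k) * Re (\<zeta> l) + Im (\<zeta> k) * Im (\<zeta> l))" by simp
    also have "\<dots> = x k * x l + y k * y l"
      by (simp add: x_def y_def power2_eq_square algebra_simps)
    finally show ?thesis .
  qed
  define a where "a = (1 + cmod W) / 2"
  define b where "b = (1 - cmod W) / 2"
  have ab: "0 < a" "0 \<le> b"
    using \<open>cmod W \<le> 1\<close> norm_ge_zero[of W] by (simp_all add: a_def b_def add_pos_nonneg)
  define h where "h = 1 / sqrt a"
  define u where "u k = h * x k" for k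
  have "(\<Sum>k<n. u k * u k) = h\<^sup>2 * (\<Sum>k<n. x k * x k)"
    by (simp add: u_def sum_distrib_left power2_eq_square mult_ac)
  also have "\<dots> = 1" using ab(1) unfolding xx a_def[symmetric] by (simp add: h_def power_divide)
  finally have uu: "(\<Sum>k<n. u k * u k) = 1" .
  have "(\<Sum>k<n. u k * y k) = h * (\<Sum>k<n. x k * y k)"
    by (simp only: u_def sum_distrib_left mult.assoc)
  then have uy: "(\<Sum>k<n. u k * y k) = 0" unfolding xy by simp
  obtain v where v: "orthonormal_pair n u v" "\<And>l. l < n \<Longrightarrow> y l = sqrt b * v l"
    using unit_vector_along[OF n uu uy] yy unfolding b_def[symmetric] by blast
  have xu: "x k = sqrt a * u k" for k using ab(1) by (simp add: u_def h_def)
  have "x k * x l = a * (u k * u l)" for k l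
  proof -
    have "x k * x l = (sqrt a * sqrt a) * (u k * u l)" unfolding xu by (simp only: mult_ac)
    then show ?thesis using ab(1) by simp
  qed
  moreover have "y k * y l = b * (v k * v l)" if "k < n" "l < n" for k l
  proof -
    have "y k * y l = (sqrt b * sqrt b) * (v k * v l)" using v(2) that by (simp add: mult_ac)
    then show ?thesis using ab(2) by simp
  qed
  ultimately have entry: "c * (Re (\<zeta> k) * Re (\<zeta> l)) + c * (Im (\<zeta> k) * Im (\<zeta> l))
      = (c * b) * (v k * v l) + (c * a) * (u k * u l)" if "k < n" "l < n" for k l
    using that unfolding distrib_left[symmetric] rot by (simp add: algebra_simps)
  have "identity_minus n X (c * b) v (c * a) u"
    unfolding identity_minus_def
  proof (intro allI impI)
    fix k l assume kl: "k < n" "l < n"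
    have "X $$ (k, l) = (if k = l then 1 else 0) - c * (Re (\<zeta> k) * Re (\<zeta> l)) - c * (Im (\<zeta> k) * Im (\<zeta> l))"
      using X kl by (simp add: identity_minus_def c_def)
    then show "X $$ (k, l) = (if k = l then 1 else 0) - c * b * (v k * v l) - c * a * (u k * u l)"
      using entry[OF kl] by linarith
  qed
  moreover have "orthonormal_pair n v u" using v(1) by (auto simp: orthonormal_pair_def mult.commute)
  moreover have "c * b = (1 - cmod W) / m" "c * a = (1 + cmod W) / m"
    by (cases "m = 0"; simp add: a_def b_def c_def field_simps)+
  ultimately show ?thesis using that[of v u] by (simp add: W_def)
qed

lemma locally_psd_of_feasible:
  assumes d: "d \<le> n" and z: "max_objective n d z \<le> m" "0 < m"
    and \<zeta>: "\<And>k. k < n \<Longrightarrow> (\<zeta> k)\<^sup>2 = z $ k"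
    and X: "X \<in> carrier_mat n n" "identity_minus n X (2 / m) (\<lambda>k. Re (\<zeta> k)) (2 / m) (\<lambda>k. Im (\<zeta> k))"
  shows "X \<in> locally_psd n d"
proof -
  have c: "0 \<le> 2 / m" using z(2) by simp
  then have c_norm: "cmod (of_real (2 / m)) = 2 / m" by (simp only: norm_of_real abs_of_nonneg)
  have scaled: "of_real (2 / m) * z $ k
      = (Complex (sqrt (2 / m) * Re (\<zeta> k)) (sqrt (2 / m) * Im (\<zeta> k)))\<^sup>2" if "k < n" for k
  proof -
    have "Complex (sqrt (2 / m) * Re (\<zeta> k)) (sqrt (2 / m) * Im (\<zeta> k)) = of_real (sqrt (2 / m)) * \<zeta> k"
      by (simp add: complex_eq_iff)
    then show ?thesis using c \<zeta>[OF that]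
      by (simp only: power_mult_distrib of_real_power[symmetric] real_sqrt_pow2)
  qed
  have "\<forall>S\<in>subsets_of_size n d. (\<Sum>s\<in>S. cmod (of_real (2 / m) * z $ s))
      + cmod (\<Sum>s\<in>S. of_real (2 / m) * z $ s) \<le> 2"
  proof
    fix S assume "S \<in> subsets_of_size n d"
    then have "(\<Sum>s\<in>S. cmod (z $ s)) + cmod (\<Sum>s\<in>S. z $ s) \<le> m"
      using z(1) max_objective_le_iff[OF d] by blast
    then have "2 / m * ((\<Sum>s\<in>S. cmod (z $ s)) + cmod (\<Sum>s\<in>S. z $ s)) \<le> 2 / m * m"
      using c by (rule mult_left_mono)
    then show "(\<Sum>s\<in>S. cmod (of_real (2 / m) * z $ s)) + cmod (\<Sum>s\<in>S. of_real (2 / m) * z $ s) \<le> 2"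
      using z(2) unfolding sum_distrib_left[symmetric] norm_mult c_norm distrib_left[symmetric]
      by simp
  qed
  then show ?thesis
    using locally_psd_complex_iff[OF X c c scaled] by blast
qed

lemma ones_pair_spectra_iff:
  assumes n: "2 \<le> n"
  shows "ones_pair n s t \<in> spectra n (locally_psd n d) \<longleftrightarrow>
    (\<exists>X\<in>locally_psd n d. \<exists>u v. orthonormal_pair n u v \<and> identity_minus n X (1 - s) u (1 - t) v)"
proof -
  have "similar_mat X (diag_of_vec (ones_pair n s t)) \<longleftrightarrow>
      (\<exists>u v. orthonormal_pair n u v \<and> identity_minus n X (1 - s) u (1 - t) v)"
    if "X \<in> locally_psd n d" for X
  proof -
    have "X \<in> carrier_mat n n" "symmetric_mat X" using that by (simp_all add: locally_psd_def)
    then show ?thesis using similar_ones_pairE[OF n] similar_ones_pairI[OF n] by metis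
  qed
  moreover have "ones_pair n s t \<in> carrier_vec n" by (simp add: ones_pair_def)
  ultimately show ?thesis unfolding spectra_def by blast
qed

text \<open>Any square roots of the \<open>z\<^sub>k\<close> give a suitable matrix; the principal ones serve here. The two
eigenvalues add up to \<open>2 (1 - 1 / m)\<close>, and they coincide when \<open>z\<close> has sum \<open>0\<close>.\<close>
lemma spectra_of_feasible:
  assumes n: "2 \<le> n" "d \<le> n" and z: "z \<in> mu_max_feasible n" "max_objective n d z \<le> m" "0 < m"
  defines "w \<equiv> cmod (\<Sum>k<n. z $ k)"
  shows "ones_pair n (1 - 1 / m * (1 - w)) (1 - 1 / m * (1 + w)) \<in> spectra n (locally_psd n d)"
proof -
  define \<zeta> where "\<zeta> k = csqrt (z $ k)" for k
  define X where "X = mat n n (\<lambda>(k, l). (if k = l then 1 else 0)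
    - 2 / m * (Re (\<zeta> k) * Re (\<zeta> l)) - 2 / m * (Im (\<zeta> k) * Im (\<zeta> l)))"
  have \<zeta>: "(\<zeta> k)\<^sup>2 = z $ k" for k by (simp add: \<zeta>_def)
  have X: "X \<in> carrier_mat n n" "identity_minus n X (2 / m) (\<lambda>k. Re (\<zeta> k)) (2 / m) (\<lambda>k. Im (\<zeta> k))"
    by (simp_all add: X_def identity_minus_def)
  have "X \<in> locally_psd n d" by (rule locally_psd_of_feasible[OF n(2) z(2,3) \<zeta> X])
  moreover obtain u v where "orthonormal_pair n u v"
    "identity_minus n X ((1 - w) / m) u ((1 + w) / m) v"
    using feasible_diagonalization[OF n(1) z(1) \<zeta> X(2)] unfolding w_def by blast
  ultimately show ?thesis unfolding ones_pair_spectra_iff[OF n(1)] by auto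
qed

section \<open>Equality of the optimal values\<close>

text \<open>Pairs with \<open>s + t \<ge> 2\<close> exceed the claimed minimum since \<open>mu_max n d\<close> is positive; all others have
\<open>(1 - s) + (1 - t) > 0\<close> and yield a feasible point.\<close>
lemma is_minimum_mu_tr_values:
  assumes n: "2 \<le> d" "d \<le> n"
  shows "is_minimum (2 * (1 - 1 / mu_max n d)) (mu_tr_values n d)"
proof -
  have n2: "2 \<le> n" using n by simp
  have min: "is_minimum (mu_max n d) (max_objective n d ` mu_max_feasible n)"
    using n2 n(2) by (rule is_minimum_mu_max)
  then obtain z where z: "z \<in> mu_max_feasible n" "max_objective n d z = mu_max n d"
    by (auto simp: is_minimum_def)
  have pos: "0 < mu_max n d" using max_objective_pos[OF z(1), of d] n z(2) by simp
  define w where "w = cmod (\<Sum>k<n. z $ k)"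
  have "2 * (1 - 1 / mu_max n d) \<in> mu_tr_values n d"
    unfolding mu_tr_values_def
    using spectra_of_feasible[OF n2 n(2) z(1) eq_refl[OF z(2)] pos]
    by (intro CollectI exI[of _ "1 - 1 / mu_max n d * (1 - w)"] exI[of _ "1 - 1 / mu_max n d * (1 + w)"] conjI)
      (simp_all add: w_def algebra_simps)
  moreover have "2 * (1 - 1 / mu_max n d) \<le> s + t"
    if "ones_pair n s t \<in> spectra n (locally_psd n d)" for s t
  proof (cases "2 \<le> s + t")
    case True
    moreover have "2 * (1 - 1 / mu_max n d) \<le> 2" using pos by simp
    ultimately show ?thesis by linarith
  next
    case False
    obtain X u v where X: "X \<in> locally_psd n d" "orthonormal_pair n u v"
        "identity_minus n X (1 - s) u (1 - t) v"
      using \<open>ones_pair n s t \<in> _\<close> unfolding ones_pair_spectra_iff[OF n2] by blast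
    then obtain z where "z \<in> mu_max_feasible n" "max_objective n d z \<le> 2 / ((1 - s) + (1 - t))"
      using feasible_of_locally_psd[OF n(2) X] False by force
    moreover have "(1 - s) + (1 - t) = 2 - (s + t)" by simp
    ultimately have "mu_max n d \<le> 2 / (2 - (s + t))" using min by (force simp: is_minimum_def)
    then show ?thesis using pos False by (simp add: field_simps)
  qed
  ultimately show ?thesis by (auto simp: is_minimum_def mu_tr_values_def)
qed

lemma is_minimum_pi_tr_values:
  assumes n: "2 \<le> d" "d \<le> n"
  shows "is_minimum (1 - 1 / pi_max n d) (pi_tr_values n d)"
proof -
  have n2: "2 \<le> n" using n by simp
  have min: "is_minimum (pi_max n d) (max_objective n d ` pi_max_feasible n)"
    using n2 n(2) by (rule is_minimum_pi_max)
  then obtain z where z: "z \<in> pi_max_feasible n" "max_objective n d z = pi_max n d"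
    by (auto simp: is_minimum_def)
  have z': "z \<in> mu_max_feasible n" using z(1) pi_feasible_subset by blast
  have pos: "0 < pi_max n d" using max_objective_pos[OF z', of d] n z(2) by simp
  have "1 - 1 / pi_max n d \<in> pi_tr_values n d"
    using spectra_of_feasible[OF n2 n(2) z' eq_refl[OF z(2)] pos] z(1)
    by (simp add: pi_tr_values_def pi_max_feasible_def)
  moreover have "1 - 1 / pi_max n d \<le> t"
    if "ones_pair n t t \<in> spectra n (locally_psd n d)" for t
  proof (cases "1 \<le> t")
    case True
    moreover have "0 < 1 / pi_max n d" using pos by simp
    ultimately show ?thesis by linarith
  next
    case False
    obtain X u v where X: "X \<in> locally_psd n d" "orthonormal_pair n u v"
        "identity_minus n X (1 - t) u (1 - t) v"
      using \<open>ones_pair n t t \<in> _\<close> unfolding ones_pair_spectra_iff[OF n2] by blast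
    then obtain z where "z \<in> pi_max_feasible n" "max_objective n d z \<le> 2 / ((1 - t) + (1 - t))"
      using feasible_of_semidefinite[OF n(2) X] False by force
    then have "pi_max n d \<le> 2 / ((1 - t) + (1 - t))" using min by (force simp: is_minimum_def)
    then show ?thesis using pos False by (simp add: field_simps)
  qed
  ultimately show ?thesis by (auto simp: is_minimum_def pi_tr_values_def)
qed

lemma associated_mat_identity_minus:
  "associated_mat n d a \<beta> \<in> carrier_mat n n"
  "identity_minus n (associated_mat n d a \<beta>) (2 / mu_max n d) (\<lambda>k. a k * cos (\<beta> k))
     (2 / mu_max n d) (\<lambda>k. a k * sin (\<beta> k))"
  by (auto simp: associated_mat_def polar_mat_def identity_minus_def scalar_prod_def
      numeral_2_eq_2 algebra_simps)

theorem proposition3p3: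
  fixes n d :: nat
  assumes "2 \<le> d" and "d \<le> n"
  shows "is_minimum (mu_tr n d) (mu_tr_values n d)
    \<and> is_minimum (pi_tr n d) (pi_tr_values n d)
    \<and> is_minimum (mu_max n d) (max_objective n d ` mu_max_feasible n)
    \<and> is_minimum (pi_max n d) (max_objective n d ` pi_max_feasible n)
    \<and> mu_tr n d = 2 * (1 - 1 / mu_max n d)
    \<and> pi_tr n d = 1 - 1 / pi_max n d
    \<and> (\<forall>z a \<beta>. mu_max_optimal n d z \<and> polar_data n z a \<beta> \<longrightarrow>
         associated_mat n d a \<beta> \<in> locally_psd n d
       \<and> (\<exists>s t. similar_mat (associated_mat n d a \<beta>) (diag_of_vec (ones_pair n s t)))
       \<and> (\<forall>s t. similar_mat (associated_mat n d a \<beta>) (diag_of_vec (ones_pair n s t)) \<longrightarrow>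
            s + t = mu_tr n d
          \<and> (let s' = 1 - 1 / mu_max n d * (1 - cmod (\<Sum>j<n. z $ j));
                 t' = 1 - 1 / mu_max n d * (1 + cmod (\<Sum>j<n. z $ j))
             in (s = s' \<and> t = t') \<or> (s = t' \<and> t = s'))))"
proof (intro conjI allI impI)
  have n: "2 \<le> n" using assms by simp
  show mu_tr: "mu_tr n d = 2 * (1 - 1 / mu_max n d)"
    unfolding mu_tr_def by (rule is_minimum_LEAST[OF is_minimum_mu_tr_values[OF assms]])
  show pi_tr: "pi_tr n d = 1 - 1 / pi_max n d"
    unfolding pi_tr_def by (rule is_minimum_LEAST[OF is_minimum_pi_tr_values[OF assms]])
  show "is_minimum (mu_tr n d) (mu_tr_values n d)"
    unfolding mu_tr by (rule is_minimum_mu_tr_values[OF assms])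
  show "is_minimum (pi_tr n d) (pi_tr_values n d)"
    unfolding pi_tr by (rule is_minimum_pi_tr_values[OF assms])
  show "is_minimum (mu_max n d) (max_objective n d ` mu_max_feasible n)"
    using n assms(2) by (rule is_minimum_mu_max)
  show "is_minimum (pi_max n d) (max_objective n d ` pi_max_feasible n)"
    using n assms(2) by (rule is_minimum_pi_max)
  fix z a \<beta> assume opt: "mu_max_optimal n d z \<and> polar_data n z a \<beta>"
  let ?M = "associated_mat n d a \<beta>" and ?\<mu> = "mu_max n d"
  define \<zeta> where "\<zeta> k = Complex (a k * cos (\<beta> k)) (a k * sin (\<beta> k))" for k
  have z: "z \<in> mu_max_feasible n" "max_objective n d z \<le> ?\<mu>" "0 < ?\<mu>"
    using opt max_objective_pos[of z n d] assms by (auto simp: mu_max_optimal_def)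
  have \<zeta>: "(\<zeta> k)\<^sup>2 = z $ k" if "k < n" for k
    using opt that unfolding polar_data_def \<zeta>_def cos_double sin_double
    by (simp add: complex_eq_iff power2_eq_square algebra_simps)
  have M: "?M \<in> carrier_mat n n"
      "identity_minus n ?M (2 / ?\<mu>) (\<lambda>k. Re (\<zeta> k)) (2 / ?\<mu>) (\<lambda>k. Im (\<zeta> k))"
    using associated_mat_identity_minus[of n d a \<beta>] by (simp_all add: \<zeta>_def)
  show psd: "?M \<in> locally_psd n d"
    by (rule locally_psd_of_feasible[OF assms(2) z(2,3) \<zeta> M])
  define w where "w = cmod (\<Sum>j<n. z $ j)"
  obtain u v where uv: "orthonormal_pair n u v"
    "identity_minus n ?M ((1 - w) / ?\<mu>) u ((1 + w) / ?\<mu>) v"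
    using feasible_diagonalization[OF n z(1) \<zeta> M(2)] unfolding w_def by blast
  then have id: "identity_minus n ?M (1 - (1 - 1 / ?\<mu> * (1 - w))) u (1 - (1 - 1 / ?\<mu> * (1 + w))) v"
    by simp
  show "\<exists>s t. similar_mat ?M (diag_of_vec (ones_pair n s t))"
    using similar_ones_pairI[OF n M(1) uv(1) id] by blast
  fix s t assume "similar_mat ?M (diag_of_vec (ones_pair n s t))"
  then obtain u' v' where "orthonormal_pair n u' v'" "identity_minus n ?M (1 - s) u' (1 - t) v'"
    using similar_ones_pairE[OF n M(1)] symmetric_mat_identity_minus[OF M] by blast
  from rank_two_coefficients_unique[OF this uv(1) id]
  have st: "s = 1 - 1 / ?\<mu> * (1 - w) \<and> t = 1 - 1 / ?\<mu> * (1 + w)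
      \<or> s = 1 - 1 / ?\<mu> * (1 + w) \<and> t = 1 - 1 / ?\<mu> * (1 - w)"
    by auto
  then show "s + t = mu_tr n d" unfolding mu_tr by (auto simp: add_divide_distrib diff_divide_distrib)
  show "let s' = 1 - 1 / ?\<mu> * (1 - cmod (\<Sum>j<n. z $ j));
            t' = 1 - 1 / ?\<mu> * (1 + cmod (\<Sum>j<n. z $ j))
        in (s = s' \<and> t = t') \<or> (s = t' \<and> t = s')"
    using st unfolding Let_def w_def .
qed

end
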